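(* Let $I \subset A$ and $J \subset B$ be squarefree monomial ideals, $\mathfrak{m}$ and $\mathfrak{n}$ the respective maximal homogeneous ideals of $A$ and $B$, and $s \geq 1$. Then $$\operatorname{reg}(S/(I+J+\mathfrak{m}\mathfrak{n})^{(s)}) = \max_{1 \leq t \leq s} \{\operatorname{reg}(A/I^{(t)}) + s - t,\ \operatorname{reg}(B/J^{(t)}) + s - t,\ 2s-1\}.$$
   Context: $k$ is a field of characteristic zero, $A = k[x_1,\ldots,x_m]$, $B = k[x_{m+1},\ldots,x_n]$, $S = A \otimes_k B = k[x_1,\ldots,x_n]$, $\mathfrak{m} = (x_1,\ldots,x_m)$, $\mathfrak{n} = (x_{m+1},\ldots,x_n)$. Ideals of $A$ and $B$ are identified with their extensions to $S$ when sums and products are formed in $S$. For a squarefree monomial ideal $K$, the $s$-th symbolic power is $K^{(s)} = \bigcap_{\mathfrak{p} \in \mathrm{Ass}(K)} \mathfrak{p}^s$, where $\mathrm{Ass}(K)$ is the set of associated primes of $K$. $\operatorname{reg}$ is Castelnuovo–Mumford regularity: for a $\mathbb{Z}^n$-graded module $M$ over a polynomial ring with maximal homogeneous ideal $\mathfrak{a}$, $\operatorname{reg}(M) = \max\{p + |\gamma| : H^p_{\mathfrak{a}}(M)_\gamma \neq 0\}$, where $|\gamma| = \sum_i \gamma_i$.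
   Formalization: I and J are assumed proper and I+J+mn is assumed not prime, with both sets of variables nonempty; if I = A or J = B the left side is −∞, and if I+J+mn is prime (e.g. I = m, J = n) it is s−1 < 2s−1, so the formula fails in those cases. *)

theory Defs
  imports
    "HOL-Library.Poly_Mapping"
    "HOL-Library.Extended_Real"
    "HOL-Algebra.Ideal_Product"
    "HOL-Algebra.QuotRing"
    "HOL-Algebra.Module"
    "HOL-Algebra.Product_Groups"
begin

section \<open>Polynomial rings\<close>

text \<open>
  All polynomial rings live inside one ring of polynomials in variables indexed by the natural
  numbers: an exponent vector is a finitely supported function, and a polynomial is a finitely
  supported function from exponent vectors to coefficients.  The ring \<open>k[x\<^sub>i : i \<in> V]\<close> consists of
  the polynomials all of whose monomials are supported on \<open>V\<close>.
\<close>

type_synonym 'k mpoly = "(nat \<Rightarrow>\<^sub>0 nat) \<Rightarrow>\<^sub>0 'k"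

definition poly_ring :: "nat set \<Rightarrow> 'k::comm_ring_1 mpoly ring" where
  "poly_ring V =
     \<lparr>carrier = {f. \<forall>e\<in>Poly_Mapping.keys f. Poly_Mapping.keys e \<subseteq> V},
      mult = (*), one = 1, zero = 0, add = (+)\<rparr>"

abbreviation monomial :: "(nat \<Rightarrow>\<^sub>0 nat) \<Rightarrow> 'k::comm_ring_1 mpoly" where
  "monomial e \<equiv> Poly_Mapping.single e 1"

definition max_hom_ideal :: "nat set \<Rightarrow> 'k::comm_ring_1 mpoly set" where
  "max_hom_ideal V =
     Idl\<^bsub>poly_ring V\<^esub> ((\<lambda>i. monomial (Poly_Mapping.single i 1)) ` V)"

definition squarefree_monomial_ideal :: "nat set \<Rightarrow> 'k::comm_ring_1 mpoly set \<Rightarrow> bool" where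
  "squarefree_monomial_ideal V K \<longleftrightarrow>
     (\<exists>E. (\<forall>e\<in>E. Poly_Mapping.keys e \<subseteq> V \<and> (\<forall>i. Poly_Mapping.lookup e i \<le> 1)) \<and>
          K = Idl\<^bsub>poly_ring V\<^esub> (monomial ` E))"


section \<open>Ideal powers, associated primes, symbolic powers\<close>

primrec ideal_pow :: "('a, 'c) ring_scheme \<Rightarrow> 'a set \<Rightarrow> nat \<Rightarrow> 'a set" where
  "ideal_pow R P 0 = carrier R"
| "ideal_pow R P (Suc s) = ideal_prod R P (ideal_pow R P s)"

text \<open>As usual, the associated primes of an ideal \<open>K\<close> are those of the module \<open>R/K\<close>, i.e. the prime
  ideals of the form \<open>K : f\<close>.\<close>

definition Ass :: "('a, 'c) ring_scheme \<Rightarrow> 'a set \<Rightarrow> 'a set set" where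
  "Ass R K =
     {P. primeideal P R \<and> (\<exists>f\<in>carrier R. P = {r \<in> carrier R. r \<otimes>\<^bsub>R\<^esub> f \<in> K})}"

text \<open>This is the symbolic power only for ideals without embedded primes, e.g. squarefree monomial
  ideals.  The intersection with the carrier matters only if there are no associated primes.\<close>

definition symbolic_power :: "('a, 'c) ring_scheme \<Rightarrow> 'a set \<Rightarrow> nat \<Rightarrow> 'a set" where
  "symbolic_power R K s = carrier R \<inter> (\<Inter>P\<in>Ass R K. ideal_pow R P s)"


section \<open>Localization of modules\<close>

text \<open>\<open>u/w\<close> and \<open>v/z\<close> are the same fraction iff \<open>t(zu) = t(wv)\<close> for some \<open>t\<close> in the
  multiplicative set \<open>W\<close>; a fraction is an equivalence class of pairs.\<close>

definition frac_rel :: "('a, 'b, 'c) module_scheme \<Rightarrow> 'a set \<Rightarrow> (('b \<times> 'a) \<times> ('b \<times> 'a)) set" where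
  "frac_rel M W =
     {((u, w), (v, z)). u \<in> carrier M \<and> w \<in> W \<and> v \<in> carrier M \<and> z \<in> W \<and>
        (\<exists>t\<in>W. t \<odot>\<^bsub>M\<^esub> (z \<odot>\<^bsub>M\<^esub> u) = t \<odot>\<^bsub>M\<^esub> (w \<odot>\<^bsub>M\<^esub> v))}"

definition fraction :: "('a, 'b, 'c) module_scheme \<Rightarrow> 'a set \<Rightarrow> 'b \<Rightarrow> 'a \<Rightarrow> ('b \<times> 'a) set" where
  "fraction M W u w = frac_rel M W `` {(u, w)}"

text \<open>The fields \<open>mult\<close> and \<open>one\<close>, which the module record inherits from the ring record, play no
  role for a module.\<close>

definition localization ::
  "('a, 'd) ring_scheme \<Rightarrow> ('a, 'b, 'c) module_scheme \<Rightarrow> 'a set \<Rightarrow> ('a, ('b \<times> 'a) set) module" where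
  "localization R M W =
     \<lparr>carrier = (carrier M \<times> W) // frac_rel M W,
      mult = (\<lambda>_ _. undefined),
      one = undefined,
      zero = fraction M W \<zero>\<^bsub>M\<^esub> \<one>\<^bsub>R\<^esub>,
      add = (\<lambda>X Y. \<Union>(u, w)\<in>X. \<Union>(v, z)\<in>Y.
               fraction M W (z \<odot>\<^bsub>M\<^esub> u \<oplus>\<^bsub>M\<^esub> w \<odot>\<^bsub>M\<^esub> v) (w \<otimes>\<^bsub>R\<^esub> z)),
      smult = (\<lambda>a X. \<Union>(u, w)\<in>X. fraction M W (a \<odot>\<^bsub>M\<^esub> u) w)\<rparr>"


section \<open>Local cohomology of multigraded modules\<close>

text \<open>
  Local cohomology with support in \<open>(x\<^sub>i : i \<in> V)\<close> is the cohomology of the Cech complex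
  \<open>C\<^sup>p(M) = \<Oplus> M\<^bsub>x_F\<^esub>\<close>, where \<open>F\<close> ranges over the \<open>p\<close>-element subsets of \<open>V\<close> and \<open>M\<^bsub>x_F\<^esub>\<close> is
  the localization of \<open>M\<close> inverting the variables \<open>x\<^sub>i\<close> with \<open>i \<in> F\<close>.

  A multidegree is a function \<open>\<gamma>\<close> vanishing outside \<open>V\<close>.  The grading of a module \<open>M\<close> over
  \<open>poly_ring V\<close> is given by the family \<open>G\<close> of its graded pieces.  For multigraded \<open>M\<close> the Cech
  complex is a complex of multigraded modules and degree-preserving maps, so \<open>H\<^sup>p(M)\<^sub>\<gamma>\<close> is the
  cohomology of its strand of degree \<open>\<gamma>\<close>.
\<close>

type_synonym ('k, 'b) pmodule = "('k mpoly, 'b) module"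

definition monomials_on :: "nat set \<Rightarrow> 'k::comm_ring_1 mpoly set" where
  "monomials_on F = {monomial e | e. Poly_Mapping.keys e \<subseteq> F}"

definition loc_at :: "nat set \<Rightarrow> ('k::comm_ring_1, 'b) pmodule \<Rightarrow> nat set \<Rightarrow> ('k, ('b \<times> 'k mpoly) set) pmodule" where
  "loc_at V M F = localization (poly_ring V) M (monomials_on F)"

definition loc_piece ::
  "('k::comm_ring_1, 'b) pmodule \<Rightarrow> ((nat \<Rightarrow> int) \<Rightarrow> 'b set) \<Rightarrow> nat set \<Rightarrow> (nat \<Rightarrow> int)
     \<Rightarrow> ('b \<times> 'k mpoly) set set" where
  "loc_piece M G F \<gamma> =
     {fraction M (monomials_on F) u (monomial e) | u e.
        Poly_Mapping.keys e \<subseteq> F \<and> u \<in> G (\<lambda>i. \<gamma> i + int (Poly_Mapping.lookup e i))}"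

definition faces :: "nat set \<Rightarrow> nat \<Rightarrow> nat set set" where
  "faces V p = {F. F \<subseteq> V \<and> card F = p}"

definition cech_group ::
  "nat set \<Rightarrow> ('k::comm_ring_1, 'b) pmodule \<Rightarrow> ((nat \<Rightarrow> int) \<Rightarrow> 'b set) \<Rightarrow> nat \<Rightarrow> (nat \<Rightarrow> int)
     \<Rightarrow> (nat set \<Rightarrow> ('b \<times> 'k mpoly) set) monoid" where
  "cech_group V M G p \<gamma> =
     product_group (faces V p) (\<lambda>F. (add_monoid (loc_at V M F))\<lparr>carrier := loc_piece M G F \<gamma>\<rparr>)"

text \<open>The image of a fraction \<open>X\<close> under \<open>M\<^bsub>x_(F - i)\<^esub> \<rightarrow> M\<^bsub>x_F\<^esub>\<close> is the class of
  any of its representatives for the relation defining \<open>M\<^bsub>x_F\<^esub>\<close>.\<close>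

definition cech_diff ::
  "nat set \<Rightarrow> ('k::comm_ring_1, 'b) pmodule \<Rightarrow> nat
     \<Rightarrow> (nat set \<Rightarrow> ('b \<times> 'k mpoly) set) \<Rightarrow> nat set \<Rightarrow> ('b \<times> 'k mpoly) set" where
  "cech_diff V M p c =
     (\<lambda>F\<in>faces V (Suc p).
        finsum (loc_at V M F)
          (\<lambda>i. let y = frac_rel M (monomials_on F) `` c (F - {i})
               in if even (card {j \<in> F. j < i}) then y else \<ominus>\<^bsub>loc_at V M F\<^esub> y)
          F)"

definition cech_boundaries ::
  "nat set \<Rightarrow> ('k::comm_ring_1, 'b) pmodule \<Rightarrow> ((nat \<Rightarrow> int) \<Rightarrow> 'b set) \<Rightarrow> nat \<Rightarrow> (nat \<Rightarrow> int)
     \<Rightarrow> (nat set \<Rightarrow> ('b \<times> 'k mpoly) set) set" where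
  "cech_boundaries V M G p \<gamma> =
     (case p of 0 \<Rightarrow> {\<one>\<^bsub>cech_group V M G 0 \<gamma>\<^esub>}
      | Suc q \<Rightarrow> cech_diff V M q ` carrier (cech_group V M G q \<gamma>))"

definition local_cohomology ::
  "nat set \<Rightarrow> ('k::comm_ring_1, 'b) pmodule \<Rightarrow> ((nat \<Rightarrow> int) \<Rightarrow> 'b set) \<Rightarrow> nat \<Rightarrow> (nat \<Rightarrow> int)
     \<Rightarrow> (nat set \<Rightarrow> ('b \<times> 'k mpoly) set) set monoid" where
  "local_cohomology V M G p \<gamma> =
     (cech_group V M G p \<gamma>)
       \<lparr>carrier := kernel (cech_group V M G p \<gamma>) (cech_group V M G (Suc p) \<gamma>) (cech_diff V M p)\<rparr>
     Mod cech_boundaries V M G p \<gamma>"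

text \<open>The supremum in the extended reals of a set of integers is its maximum whenever the set is
  nonempty and bounded above; the regularity of the zero module is \<open>-\<infinity>\<close>.\<close>

definition regularity ::
  "nat set \<Rightarrow> ('k::comm_ring_1, 'b) pmodule \<Rightarrow> ((nat \<Rightarrow> int) \<Rightarrow> 'b set) \<Rightarrow> ereal" where
  "regularity V M G =
     Sup {ereal (of_int (int p + (\<Sum>i\<in>V. \<gamma> i))) | p \<gamma>.
        (\<forall>i. i \<notin> V \<longrightarrow> \<gamma> i = 0) \<and>
        carrier (local_cohomology V M G p \<gamma>) \<noteq> {\<one>\<^bsub>local_cohomology V M G p \<gamma>\<^esub>}}"


section \<open>Quotients by monomial ideals\<close>

definition quot_module :: "('a, 'c) ring_scheme \<Rightarrow> 'a set \<Rightarrow> ('a, 'a set) module" where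
  "quot_module R K =
     \<lparr>carrier = carrier (R Quot K), mult = mult (R Quot K), one = one (R Quot K),
      zero = zero (R Quot K), add = add (R Quot K),
      smult = (\<lambda>a X. mult (R Quot K) (K +>\<^bsub>R\<^esub> a) X)\<rparr>"

definition quot_grading ::
  "nat set \<Rightarrow> 'k::comm_ring_1 mpoly set \<Rightarrow> (nat \<Rightarrow> int) \<Rightarrow> 'k mpoly set set" where
  "quot_grading V K \<gamma> =
     (\<lambda>f. K +>\<^bsub>poly_ring V\<^esub> f) `
       {f \<in> carrier (poly_ring V). \<forall>e\<in>Poly_Mapping.keys f. \<forall>i. int (Poly_Mapping.lookup e i) = \<gamma> i}"

definition reg_quot :: "nat set \<Rightarrow> 'k::comm_ring_1 mpoly set \<Rightarrow> ereal" where
  "reg_quot V K = regularity V (quot_module (poly_ring V) K) (quot_grading V K)"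


section \<open>The ideal \<open>I + J + mn\<close>\<close>

definition fiber_ideal ::
  "nat \<Rightarrow> nat \<Rightarrow> 'k::comm_ring_1 mpoly set \<Rightarrow> 'k mpoly set \<Rightarrow> 'k mpoly set" where
  "fiber_ideal m n I J =
     (let S = poly_ring {1..n} in
      (Idl\<^bsub>S\<^esub> I <+>\<^bsub>S\<^esub> Idl\<^bsub>S\<^esub> J) <+>\<^bsub>S\<^esub>
        ideal_prod S (Idl\<^bsub>S\<^esub> (max_hom_ideal {1..m})) (Idl\<^bsub>S\<^esub> (max_hom_ideal {m+1..n})))"

end

theory Submission
  imports Defs
begin

text \<open>
  In degree \<open>\<gamma>\<close> the Cech complex of \<open>S/K\<^sup>(\<^sup>s\<^sup>)\<close>, for a squarefree monomial ideal \<open>K\<close> with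
  Stanley-Reisner complex \<open>D\<close>, is the cochain complex of the faces \<open>F\<close> that contain the negative
  support of \<open>\<gamma>\<close> and lie in some \<open>F'\<close> of \<open>D\<close> such that the entries of \<open>\<gamma>\<close> off \<open>F'\<close> add up to less than
  \<open>s\<close> (Takayama's formula).  The complex of \<open>I + J + mn\<close> is the disjoint union of the complexes of
  \<open>I\<close> and \<open>J\<close>, glued along the empty face.  So in degree \<open>\<gamma> = (\<beta>, \<delta>)\<close> one gets the union of the
  complex of \<open>I\<^sup>(\<^sup>t\<^sup>)\<close> in degree \<open>\<beta>\<close>, \<open>t = s - |\<delta>|\<close>, and that of \<open>J\<^sup>(\<^sup>t\<^sup>)\<close> in degree \<open>\<delta>\<close>,
  \<open>t = s - |\<beta>|\<close>.  If \<open>\<gamma>\<close> has negative entries, at most one of the two is nonempty; otherwise the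
  cohomology splits in positions \<open>p \<ge> 2\<close>, while in positions \<open>p \<le> 1\<close> two nonempty complexes
  contribute at most \<open>2s - 1\<close>.  Finally, \<open>2s - 1\<close> is attained by every squarefree monomial ideal that
  is not prime.
\<close>

section \<open>Localization\<close>

text \<open>Positions count the vertices of a face, so the empty face sits in position 0. From
  \<open>p = 2\<close> on, the cardinalities \<open>p - 1\<close>, \<open>p\<close>,
  \<open>p + 1\<close> involved are all positive, while the empty face is the only one that the two
  complexes share; this is why the splitting starts there. The threshold drops by |\<delta>| because
  a face of the complex of \<open>I\<close> avoids the variables of \<open>B\<close>, so that all of
  \<delta> is counted off it. If there are no negative entries and both complexes are nonempty, then
  both thresholds are positive, so |\<beta>| and |\<delta>| are at most \<open>s - 1\<close>; with
  \<open>p \<le> 1\<close> this gives the constant \<open>2s - 1\<close>. Conversely, a shift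
  \<open>s - t\<close> is realized by placing \<open>s - t\<close> on one variable of the other
  block. A class that the gluing destroys has \<open>p \<le> 1\<close>, hence a degree of at most
  \<open>2s - 1\<close>, and is made up for by the lower bound. That bound fails if the complex is a
  simplex: the ideal is then a prime generated by variables, and the quotient has regularity
  \<open>s - 1\<close>. Hence the assumption that the ideal is not prime.\<close>

locale module_localization = module R M
  for R :: "('a, 'c) ring_scheme" (structure) and M :: "('a, 'b, 'd) module_scheme" (structure) +
  fixes W :: "'a set"
  assumes W_carrier: "W \<subseteq> carrier R"
    and W_one: "\<one> \<in> W"
    and W_mult: "\<lbrakk>w \<in> W; z \<in> W\<rbrakk> \<Longrightarrow> w \<otimes> z \<in> W"
begin

abbreviation L where "L \<equiv> localization R M W"

lemma W_in_carrier [simp]: "w \<in> W \<Longrightarrow> w \<in> carrier R"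
  using W_carrier by blast

lemmas smult_ac = smult_assoc1[symmetric] R.m_ac

lemma frac_rel_iff:
  assumes "u \<in> carrier M" "w \<in> W" "v \<in> carrier M" "z \<in> W"
  shows "((u, w), (v, z)) \<in> frac_rel M W \<longleftrightarrow>
    (\<exists>t\<in>W. t \<odot>\<^bsub>M\<^esub> (z \<odot>\<^bsub>M\<^esub> u) = t \<odot>\<^bsub>M\<^esub> (w \<odot>\<^bsub>M\<^esub> v))"
  using assms by (simp add: frac_rel_def)

lemma equiv_frac_rel: "equiv (carrier M \<times> W) (frac_rel M W)"
proof (rule equivI)
  show "frac_rel M W \<subseteq> (carrier M \<times> W) \<times> (carrier M \<times> W)"
    by (auto simp: frac_rel_def)
  show "refl_on (carrier M \<times> W) (frac_rel M W)"
    using W_one by (auto simp: frac_rel_def refl_on_def)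
  show "sym (frac_rel M W)"
    by (rule symI) (auto simp: frac_rel_def, metis)
  show "trans (frac_rel M W)"
  proof (rule transI, clarify)
    fix u w v z x y
    assume "((u, w), (v, z)) \<in> frac_rel M W" "((v, z), (x, y)) \<in> frac_rel M W"
    then obtain t t' where 1: "u \<in> carrier M" "w \<in> W" "v \<in> carrier M" "z \<in> W" "x \<in> carrier M" "y \<in> W"
      "t \<in> W" "t' \<in> W" and t: "t \<odot>\<^bsub>M\<^esub> (z \<odot>\<^bsub>M\<^esub> u) = t \<odot>\<^bsub>M\<^esub> (w \<odot>\<^bsub>M\<^esub> v)"
      and t': "t' \<odot>\<^bsub>M\<^esub> (y \<odot>\<^bsub>M\<^esub> v) = t' \<odot>\<^bsub>M\<^esub> (z \<odot>\<^bsub>M\<^esub> x)"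
      by (auto simp: frac_rel_def)
    have "(t \<otimes> t' \<otimes> z) \<odot>\<^bsub>M\<^esub> (y \<odot>\<^bsub>M\<^esub> u) = (t' \<otimes> y) \<odot>\<^bsub>M\<^esub> (t \<odot>\<^bsub>M\<^esub> (z \<odot>\<^bsub>M\<^esub> u))"
      using 1 by (simp add: smult_ac)
    also have "\<dots> = (t \<otimes> w) \<odot>\<^bsub>M\<^esub> (t' \<odot>\<^bsub>M\<^esub> (y \<odot>\<^bsub>M\<^esub> v))"
      unfolding t using 1 by (simp add: smult_ac)
    also have "\<dots> = (t \<otimes> t' \<otimes> z) \<odot>\<^bsub>M\<^esub> (w \<odot>\<^bsub>M\<^esub> x)"
      unfolding t' using 1 by (simp add: smult_ac)
    finally show "((u, w), (x, y)) \<in> frac_rel M W"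
      using 1 unfolding frac_rel_def by (blast intro: W_mult)
  qed
qed

lemma fraction_eq_iff:
  assumes "u \<in> carrier M" "w \<in> W" "v \<in> carrier M" "z \<in> W"
  shows "fraction M W u w = fraction M W v z \<longleftrightarrow>
    (\<exists>t\<in>W. t \<odot>\<^bsub>M\<^esub> (z \<odot>\<^bsub>M\<^esub> u) = t \<odot>\<^bsub>M\<^esub> (w \<odot>\<^bsub>M\<^esub> v))"
  unfolding fraction_def
  using eq_equiv_class_iff[OF equiv_frac_rel, of "(u, w)" "(v, z)"] frac_rel_iff[OF assms] assms
  by blast

lemma fraction_eqI:
  assumes "u \<in> carrier M" "w \<in> W" "v \<in> carrier M" "z \<in> W" "z \<odot>\<^bsub>M\<^esub> u = w \<odot>\<^bsub>M\<^esub> v"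
  shows "fraction M W u w = fraction M W v z"
  using assms W_one fraction_eq_iff by metis

lemma mem_fraction_iff:
  assumes "u \<in> carrier M" "w \<in> W"
  shows "(v, z) \<in> fraction M W u w \<longleftrightarrow>
    v \<in> carrier M \<and> z \<in> W \<and> fraction M W v z = fraction M W u w"
  using assms equiv_class_eq[OF equiv_frac_rel] eq_equiv_class_iff[OF equiv_frac_rel, of "(u, w)" "(v, z)"]
  unfolding fraction_def by (auto simp: frac_rel_def)

lemma fraction_self: "\<lbrakk>u \<in> carrier M; w \<in> W\<rbrakk> \<Longrightarrow> (u, w) \<in> fraction M W u w"
  by (simp add: mem_fraction_iff)

lemma fraction_closed [simp]: "\<lbrakk>u \<in> carrier M; w \<in> W\<rbrakk> \<Longrightarrow> fraction M W u w \<in> carrier L"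
  unfolding localization_def fraction_def by (auto intro: quotientI)

lemma carrier_localizationE:
  assumes "X \<in> carrier L"
  obtains u w where "u \<in> carrier M" "w \<in> W" "X = fraction M W u w"
  using assms unfolding localization_def fraction_def by (auto elim!: quotientE)

lemma zero_localization: "\<zero>\<^bsub>L\<^esub> = fraction M W \<zero>\<^bsub>M\<^esub> \<one>"
  by (simp add: localization_def)

lemma fraction_zero: "w \<in> W \<Longrightarrow> fraction M W \<zero>\<^bsub>M\<^esub> w = \<zero>\<^bsub>L\<^esub>"
  unfolding zero_localization by (rule fraction_eqI) (auto simp: W_one)

text \<open>Addition in \<open>localization\<close> is a union over all pairs of representatives;
  independence of the representatives makes that union a single class. The witnesses
  \<open>t\<close> and \<open>r\<close> of the two equalities combine to
  \<open>t \<otimes> r\<close>.\<close>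

lemma fraction_add_cong:
  assumes "u \<in> carrier M" "w \<in> W" "v \<in> carrier M" "z \<in> W"
    and "u' \<in> carrier M" "w' \<in> W" "v' \<in> carrier M" "z' \<in> W"
    and "fraction M W u' w' = fraction M W u w" "fraction M W v' z' = fraction M W v z"
  shows "fraction M W (z' \<odot>\<^bsub>M\<^esub> u' \<oplus>\<^bsub>M\<^esub> w' \<odot>\<^bsub>M\<^esub> v') (w' \<otimes> z') =
    fraction M W (z \<odot>\<^bsub>M\<^esub> u \<oplus>\<^bsub>M\<^esub> w \<odot>\<^bsub>M\<^esub> v) (w \<otimes> z)"
proof -
  note [simp] = assms(1-8)
  obtain t where [simp]: "t \<in> W" and t: "t \<odot>\<^bsub>M\<^esub> (w \<odot>\<^bsub>M\<^esub> u') = t \<odot>\<^bsub>M\<^esub> (w' \<odot>\<^bsub>M\<^esub> u)"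
    using assms fraction_eq_iff by blast
  obtain r where [simp]: "r \<in> W" and r: "r \<odot>\<^bsub>M\<^esub> (z \<odot>\<^bsub>M\<^esub> v') = r \<odot>\<^bsub>M\<^esub> (z' \<odot>\<^bsub>M\<^esub> v)"
    using assms fraction_eq_iff by blast
  have "(t \<otimes> r) \<odot>\<^bsub>M\<^esub> ((w \<otimes> z) \<odot>\<^bsub>M\<^esub> (z' \<odot>\<^bsub>M\<^esub> u' \<oplus>\<^bsub>M\<^esub> w' \<odot>\<^bsub>M\<^esub> v')) =
     (r \<otimes> z \<otimes> z') \<odot>\<^bsub>M\<^esub> (t \<odot>\<^bsub>M\<^esub> (w \<odot>\<^bsub>M\<^esub> u')) \<oplus>\<^bsub>M\<^esub> (t \<otimes> w \<otimes> w') \<odot>\<^bsub>M\<^esub> (r \<odot>\<^bsub>M\<^esub> (z \<odot>\<^bsub>M\<^esub> v'))"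
    by (simp add: smult_r_distr smult_ac)
  also have "\<dots> = (t \<otimes> r) \<odot>\<^bsub>M\<^esub> ((w' \<otimes> z') \<odot>\<^bsub>M\<^esub> (z \<odot>\<^bsub>M\<^esub> u \<oplus>\<^bsub>M\<^esub> w \<odot>\<^bsub>M\<^esub> v))"
    unfolding t r by (simp add: smult_r_distr smult_ac)
  finally show ?thesis
    by (subst fraction_eq_iff) (auto simp: W_mult intro!: bexI[of _ "t \<otimes> r"])
qed

lemma add_fraction:
  assumes [simp]: "u \<in> carrier M" "w \<in> W" "v \<in> carrier M" "z \<in> W"
  shows "fraction M W u w \<oplus>\<^bsub>L\<^esub> fraction M W v z =
    fraction M W (z \<odot>\<^bsub>M\<^esub> u \<oplus>\<^bsub>M\<^esub> w \<odot>\<^bsub>M\<^esub> v) (w \<otimes> z)" (is "_ = ?F")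
proof -
  have inner: "(\<Union>q\<in>fraction M W v z. case q of (v', z') \<Rightarrow>
      fraction M W (z' \<odot>\<^bsub>M\<^esub> u' \<oplus>\<^bsub>M\<^esub> w' \<odot>\<^bsub>M\<^esub> v') (w' \<otimes> z')) = ?F"
    if p: "(u', w') \<in> fraction M W u w" for u' w'
  proof (rule SUP_eq_const)
    show "fraction M W v z \<noteq> {}"
      using fraction_self[of v z] by auto
    fix q assume "q \<in> fraction M W v z"
    then obtain v' z' where q: "q = (v', z')" "(v', z') \<in> fraction M W v z"
      by (cases q) simp
    show "(case q of (v', z') \<Rightarrow>
      fraction M W (z' \<odot>\<^bsub>M\<^esub> u' \<oplus>\<^bsub>M\<^esub> w' \<odot>\<^bsub>M\<^esub> v') (w' \<otimes> z')) = ?F"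
      unfolding q(1) prod.case
      by (rule fraction_add_cong) (use p q(2) in \<open>simp_all add: mem_fraction_iff\<close>)
  qed
  have "fraction M W u w \<oplus>\<^bsub>L\<^esub> fraction M W v z =
    (\<Union>p\<in>fraction M W u w. case p of (u', w') \<Rightarrow> \<Union>q\<in>fraction M W v z. case q of (v', z') \<Rightarrow>
      fraction M W (z' \<odot>\<^bsub>M\<^esub> u' \<oplus>\<^bsub>M\<^esub> w' \<odot>\<^bsub>M\<^esub> v') (w' \<otimes> z'))"
    by (simp add: localization_def)
  also have "\<dots> = ?F"
  proof (rule SUP_eq_const)
    show "fraction M W u w \<noteq> {}"
      using fraction_self[of u w] by auto
    fix p assume "p \<in> fraction M W u w"
    then obtain u' w' where "p = (u', w')" "(u', w') \<in> fraction M W u w"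
      by (cases p) simp
    then show "(case p of (u', w') \<Rightarrow> \<Union>q\<in>fraction M W v z. case q of (v', z') \<Rightarrow>
      fraction M W (z' \<odot>\<^bsub>M\<^esub> u' \<oplus>\<^bsub>M\<^esub> w' \<odot>\<^bsub>M\<^esub> v') (w' \<otimes> z')) = ?F"
      using inner by simp
  qed
  finally show ?thesis .
qed

lemma add_fraction_same_denominator:
  assumes "u \<in> carrier M" "w \<in> W" "v \<in> carrier M"
  shows "fraction M W u w \<oplus>\<^bsub>L\<^esub> fraction M W v w = fraction M W (u \<oplus>\<^bsub>M\<^esub> v) w"
proof -
  note [simp] = assms
  have "fraction M W (w \<odot>\<^bsub>M\<^esub> u \<oplus>\<^bsub>M\<^esub> w \<odot>\<^bsub>M\<^esub> v) (w \<otimes> w) = fraction M W (u \<oplus>\<^bsub>M\<^esub> v) w"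
    by (rule fraction_eqI) (simp_all add: W_mult smult_r_distr smult_assoc1)
  then show ?thesis
    by (simp add: add_fraction)
qed

lemma abelian_group_localization: "abelian_group L"
proof (rule abelian_groupI)
  fix X Y Z
  assume X: "X \<in> carrier L" and Y: "Y \<in> carrier L" and Z: "Z \<in> carrier L"
  obtain u w where [simp]: "u \<in> carrier M" "w \<in> W" "X = fraction M W u w"
    using X by (rule carrier_localizationE)
  obtain v z where [simp]: "v \<in> carrier M" "z \<in> W" "Y = fraction M W v z"
    using Y by (rule carrier_localizationE)
  obtain x y where [simp]: "x \<in> carrier M" "y \<in> W" "Z = fraction M W x y"
    using Z by (rule carrier_localizationE)
  show "X \<oplus>\<^bsub>L\<^esub> Y \<oplus>\<^bsub>L\<^esub> Z = X \<oplus>\<^bsub>L\<^esub> (Y \<oplus>\<^bsub>L\<^esub> Z)"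
    by (simp add: add_fraction W_mult smult_r_distr smult_ac M.a_ac)
next
  fix X Y
  assume X: "X \<in> carrier L" and Y: "Y \<in> carrier L"
  obtain u w where [simp]: "u \<in> carrier M" "w \<in> W" "X = fraction M W u w"
    using X by (rule carrier_localizationE)
  obtain v z where [simp]: "v \<in> carrier M" "z \<in> W" "Y = fraction M W v z"
    using Y by (rule carrier_localizationE)
  show "X \<oplus>\<^bsub>L\<^esub> Y \<in> carrier L"
    by (simp add: add_fraction W_mult)
  show "X \<oplus>\<^bsub>L\<^esub> Y = Y \<oplus>\<^bsub>L\<^esub> X"
    by (simp add: add_fraction R.m_comm M.a_comm)
next
  show "\<zero>\<^bsub>L\<^esub> \<in> carrier L"
    by (simp add: zero_localization W_one)
next
  fix X
  assume X: "X \<in> carrier L"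
  obtain u w where u [simp]: "u \<in> carrier M" "w \<in> W" "X = fraction M W u w"
    using X by (rule carrier_localizationE)
  show "\<zero>\<^bsub>L\<^esub> \<oplus>\<^bsub>L\<^esub> X = X"
    by (simp add: zero_localization W_one add_fraction)
  have "fraction M W (\<ominus>\<^bsub>M\<^esub> u) w \<oplus>\<^bsub>L\<^esub> X = \<zero>\<^bsub>L\<^esub>"
    by (simp add: add_fraction_same_denominator M.l_neg fraction_zero)
  then show "\<exists>Y\<in>carrier L. Y \<oplus>\<^bsub>L\<^esub> X = \<zero>\<^bsub>L\<^esub>"
    by (intro bexI) auto
qed

text \<open>A larger multiplicative set gives a coarser relation, so saturating a class yields the
  whole class of the same pair. This is the localization map that \<open>cech_diff\<close> writes as
  an image under \<open>frac_rel\<close>.\<close>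

lemma frac_rel_Image_fraction:
  assumes "U \<subseteq> W" "\<one> \<in> U" "u \<in> carrier M" "w \<in> U"
  shows "frac_rel M W `` fraction M U u w = fraction M W u w"
proof -
  have sub: "frac_rel M U \<subseteq> frac_rel M W"
    using assms(1) by (auto simp: frac_rel_def)
  have trans: "trans (frac_rel M W)"
    using equiv_frac_rel by (auto simp: equiv_def)
  have "((u, w), (u, w)) \<in> frac_rel M U"
    using assms by (auto simp: frac_rel_def)
  then show ?thesis
    using sub transD[OF trans, of "(u, w)"] unfolding fraction_def by blast
qed

end

section \<open>Monomial ideals\<close>

lemma keys_add_nat:
  fixes a b :: "'a \<Rightarrow>\<^sub>0 nat"
  shows "Poly_Mapping.keys (a + b) = Poly_Mapping.keys a \<union> Poly_Mapping.keys b"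
  by (auto simp: in_keys_iff lookup_add)

lemma exponent_le_imp_add:
  fixes a b :: "'a \<Rightarrow>\<^sub>0 nat"
  assumes "\<And>i. Poly_Mapping.lookup a i \<le> Poly_Mapping.lookup b i"
  shows "\<exists>h. b = a + h \<and> Poly_Mapping.keys h \<subseteq> Poly_Mapping.keys b"
proof (intro exI conjI)
  show eq: "b = a + (b - a)"
    using assms by (intro poly_mapping_eqI) (simp add: lookup_add minus_poly_mapping.rep_eq)
  show "Poly_Mapping.keys (b - a) \<subseteq> Poly_Mapping.keys b"
    by (subst (2) eq) (simp add: keys_add_nat)
qed

lemma split_variable:
  fixes e :: "'a \<Rightarrow>\<^sub>0 nat"
  assumes "i \<in> Poly_Mapping.keys e"
  shows "\<exists>h. e = Poly_Mapping.single i 1 + h \<and> Poly_Mapping.keys h \<subseteq> Poly_Mapping.keys e"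
  using assms by (intro exponent_le_imp_add) (auto simp: lookup_single when_def in_keys_iff)

lemma poly_mapping_sum_single:
  fixes f :: "'a \<Rightarrow>\<^sub>0 'b::comm_monoid_add"
  shows
  "f = (\<Sum>e\<in>Poly_Mapping.keys f. Poly_Mapping.single e (Poly_Mapping.lookup f e))"
  by (rule poly_mapping_eqI)
    (simp add: lookup_sum lookup_single when_def not_in_keys_iff_lookup_eq_zero)

lemma mem_if_terms_mem:
  fixes f :: "'a \<Rightarrow>\<^sub>0 'b::comm_monoid_add"
  assumes "0 \<in> L" and "\<And>a b. \<lbrakk>a \<in> L; b \<in> L\<rbrakk> \<Longrightarrow> a + b \<in> L"
    and "\<And>e. e \<in> Poly_Mapping.keys f \<Longrightarrow> Poly_Mapping.single e (Poly_Mapping.lookup f e) \<in> L"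
  shows "f \<in> L"
proof -
  have "(\<Sum>e\<in>E. Poly_Mapping.single e (Poly_Mapping.lookup f e)) \<in> L"
    if "finite E" "E \<subseteq> Poly_Mapping.keys f" for E
    using that by (induction E rule: finite_induct) (auto intro: assms)
  then show ?thesis
    using poly_mapping_sum_single[of f] by (metis finite_keys order_refl)
qed

text \<open>Cancellation keeps the shifted exponents distinct, so no two coefficients are
  merged.\<close>

lemma lookup_mult_single:
  fixes f :: "('a::cancel_comm_monoid_add) \<Rightarrow>\<^sub>0 'k::comm_ring_1"
  shows "Poly_Mapping.lookup (f * Poly_Mapping.single g c) (e + g) = Poly_Mapping.lookup f e * c"
proof -
  have "f * Poly_Mapping.single g c =
      (\<Sum>a\<in>Poly_Mapping.keys f. Poly_Mapping.single (a + g) (Poly_Mapping.lookup f a * c))"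
    by (subst poly_mapping_sum_single[of f]) (simp add: sum_distrib_right mult_single)
  then show ?thesis
    by (simp add: lookup_sum lookup_single when_def not_in_keys_iff_lookup_eq_zero)
qed

lemma keys_mult_single:
  fixes f :: "('a::cancel_comm_monoid_add) \<Rightarrow>\<^sub>0 'k::comm_ring_1"
  shows "Poly_Mapping.keys (f * Poly_Mapping.single g 1) = (\<lambda>e. e + g) ` Poly_Mapping.keys f"
proof (intro equalityI subsetI)
  fix x assume x: "x \<in> Poly_Mapping.keys (f * Poly_Mapping.single g 1)"
  then obtain e where "e \<in> Poly_Mapping.keys f" "x = e + g"
    using keys_mult[of f "Poly_Mapping.single g 1"] by (auto split: if_splits)
  then show "x \<in> (\<lambda>e. e + g) ` Poly_Mapping.keys f" by blast
qed (auto simp: in_keys_iff lookup_mult_single)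

section \<open>The ring of polynomials in the variables of \<open>V\<close>\<close>

lemma poly_ring_simps [simp]:
  "f \<otimes>\<^bsub>poly_ring V\<^esub> g = f * g" "f \<oplus>\<^bsub>poly_ring V\<^esub> g = f + g"
  "\<one>\<^bsub>poly_ring V\<^esub> = 1" "\<zero>\<^bsub>poly_ring V\<^esub> = 0"
  by (simp_all add: poly_ring_def)

lemma mem_poly_ring_iff:
  "f \<in> carrier (poly_ring V) \<longleftrightarrow> (\<forall>e\<in>Poly_Mapping.keys f. Poly_Mapping.keys e \<subseteq> V)"
  by (simp add: poly_ring_def)

lemma poly_ring_mono: "U \<subseteq> V \<Longrightarrow> carrier (poly_ring U) \<subseteq> carrier (poly_ring V)"
  by (simp add: subset_iff mem_poly_ring_iff)

lemma single_mem_poly_ring: "Poly_Mapping.keys e \<subseteq> V \<Longrightarrow> Poly_Mapping.single e c \<in> carrier (poly_ring V)"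
  by (simp add: mem_poly_ring_iff)

lemma mult_mem_poly_ring:
  "\<lbrakk>f \<in> carrier (poly_ring V); g \<in> carrier (poly_ring V)\<rbrakk> \<Longrightarrow> f * g \<in> carrier (poly_ring V)"
  using keys_mult[of f g] by (fastforce simp: mem_poly_ring_iff keys_add_nat)

lemma cring_poly_ring: "cring (poly_ring V)"
proof (rule cringI)
  show "abelian_group (poly_ring V)"
  proof (rule abelian_groupI)
    fix f assume "f \<in> carrier (poly_ring V)"
    then show "\<exists>g\<in>carrier (poly_ring V). g \<oplus>\<^bsub>poly_ring V\<^esub> f = \<zero>\<^bsub>poly_ring V\<^esub>"
      by (intro bexI[of _ "- f"]) (auto simp: mem_poly_ring_iff in_keys_iff)
  qed (use keys_add in \<open>fastforce simp: mem_poly_ring_iff add_ac\<close>)+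
  show "comm_monoid (poly_ring V)"
    by (rule comm_monoidI) (auto simp: mult_mem_poly_ring mult_ac, auto simp: mem_poly_ring_iff)
qed (simp add: distrib_right)

lemma minus_poly_ring: "f \<in> carrier (poly_ring V) \<Longrightarrow> \<ominus>\<^bsub>poly_ring V\<^esub> f = - f"
  using cring_poly_ring
  by (intro abelian_group.minus_equality) (auto simp: cring_def ring_def mem_poly_ring_iff in_keys_iff)

lemma ring_poly_ring: "ring (poly_ring V)"
  using cring_poly_ring by (rule cring.axioms)

section \<open>Ideals described by the exponents of their monomials\<close>

definition mon_ideal :: "nat set \<Rightarrow> (nat \<Rightarrow>\<^sub>0 nat) set \<Rightarrow> 'k::comm_ring_1 mpoly set" where
  "mon_ideal V X = {f \<in> carrier (poly_ring V). Poly_Mapping.keys f \<subseteq> X}"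

lemma single_mem_mon_ideal:
  "\<lbrakk>e \<in> X; Poly_Mapping.keys e \<subseteq> V\<rbrakk> \<Longrightarrow> Poly_Mapping.single e c \<in> mon_ideal V X"
  by (simp add: mon_ideal_def mem_poly_ring_iff)

lemma ideal_mon_ideal:
  assumes "\<And>e h. e \<in> X \<Longrightarrow> e + h \<in> X"
  shows "ideal (mon_ideal V X :: 'k::comm_ring_1 mpoly set) (poly_ring V)"
proof (rule idealI)
  show "ring (poly_ring V :: 'k mpoly ring)" by (rule ring_poly_ring)
  show "subgroup (mon_ideal V X :: 'k mpoly set) (add_monoid (poly_ring V))"
  proof (rule group.subgroupI)
    show "Group.group (add_monoid (poly_ring V :: 'k mpoly ring))"
      using ring_poly_ring abelian_group.a_group ring.is_abelian_group by blast
    fix f g :: "'k mpoly" assume f: "f \<in> mon_ideal V X" and g: "g \<in> mon_ideal V X"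
    show "f \<otimes>\<^bsub>add_monoid (poly_ring V)\<^esub> g \<in> mon_ideal V X"
      using keys_add[of f g] f g by (simp add: mon_ideal_def mem_poly_ring_iff) blast
    have "inv\<^bsub>add_monoid (poly_ring V)\<^esub> f = - f"
      using minus_poly_ring[of f V] f unfolding a_inv_def by (auto simp: mon_ideal_def)
    then show "inv\<^bsub>add_monoid (poly_ring V)\<^esub> f \<in> mon_ideal V X"
      using f by (auto simp: mon_ideal_def mem_poly_ring_iff in_keys_iff)
  next
    have "0 \<in> mon_ideal V X" by (simp add: mon_ideal_def mem_poly_ring_iff)
    then show "mon_ideal V X \<noteq> {}" by blast
  qed (auto simp: mon_ideal_def)
next
  have *: "f * g \<in> mon_ideal V X"
    if "f \<in> mon_ideal V X" "g \<in> carrier (poly_ring V)" for f g :: "'k mpoly"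
    using that keys_mult[of f g] assms mult_mem_poly_ring[of f V g]
    by (fastforce simp: mon_ideal_def)
  fix f g :: "'k mpoly" assume "f \<in> mon_ideal V X" "g \<in> carrier (poly_ring V)"
  from *[OF this] show "f \<otimes>\<^bsub>poly_ring V\<^esub> g \<in> mon_ideal V X" "g \<otimes>\<^bsub>poly_ring V\<^esub> f \<in> mon_ideal V X"
    by (simp_all add: mult.commute)
qed

lemma ideal_poly_ringD:
  assumes "ideal L (poly_ring V)"
  shows "0 \<in> L" "\<lbrakk>a \<in> L; b \<in> L\<rbrakk> \<Longrightarrow> a + b \<in> L"
    "\<lbrakk>a \<in> L; r \<in> carrier (poly_ring V)\<rbrakk> \<Longrightarrow> r * a \<in> L"
    "\<lbrakk>a \<in> L; r \<in> carrier (poly_ring V)\<rbrakk> \<Longrightarrow> a * r \<in> L"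
  using additive_subgroup.zero_closed[OF ideal.axioms(1)[OF assms]]
    additive_subgroup.a_closed[OF ideal.axioms(1)[OF assms]]
    ideal.I_l_closed[OF assms] ideal.I_r_closed[OF assms]
  unfolding poly_ring_simps by blast+

lemma mon_ideal_subset_ideal:
  fixes L :: "'k::comm_ring_1 mpoly set"
  assumes "ideal L (poly_ring V)"
    and "\<And>e c. \<lbrakk>e \<in> X; Poly_Mapping.keys e \<subseteq> V\<rbrakk> \<Longrightarrow> Poly_Mapping.single e c \<in> L"
  shows "mon_ideal V X \<subseteq> L"
proof
  fix f :: "'k mpoly" assume "f \<in> mon_ideal V X"
  then have "Poly_Mapping.single e (Poly_Mapping.lookup f e) \<in> L"
    if "e \<in> Poly_Mapping.keys f" for e
    using that by (intro assms(2)) (auto simp: mon_ideal_def mem_poly_ring_iff)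
  with ideal_poly_ringD(1,2)[OF assms(1)] show "f \<in> L"
    by (rule mem_if_terms_mem[of L])
qed

lemma single_add_mem_ideal:
  assumes "ideal L (poly_ring V)" "monomial g \<in> L" "Poly_Mapping.keys h \<subseteq> V"
  shows "Poly_Mapping.single (g + h) c \<in> L"
  using ideal_poly_ringD(4)[OF assms(1,2) single_mem_poly_ring[OF assms(3), of c]]
  by (simp add: mult_single)

section \<open>Simplicial complexes and Stanley-Reisner ideals\<close>

definition simplicial :: "nat set \<Rightarrow> nat set set \<Rightarrow> bool" where
  "simplicial V D \<longleftrightarrow> (\<forall>F\<in>D. F \<subseteq> V \<and> Pow F \<subseteq> D)"

lemma simplicial_Pow: "F \<subseteq> V \<Longrightarrow> simplicial V (Pow F)"
  by (auto simp: simplicial_def)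

text \<open>The Stanley-Reisner ideal, spanned by the monomials supported on nonfaces.
  \<open>sr_ideal V (Pow F)\<close> is the prime generated by the variables of \<open>V - F\<close>;
  the complex \<open>{{}}\<close> gives the ideal of all variables, the void complex
  \<open>{}\<close> the unit ideal.\<close>

definition sr_ideal :: "nat set \<Rightarrow> nat set set \<Rightarrow> 'k::comm_ring_1 mpoly set" where
  "sr_ideal V D = mon_ideal V {e. Poly_Mapping.keys e \<notin> D}"

lemma ideal_sr_ideal: "simplicial V D \<Longrightarrow> ideal (sr_ideal V D) (poly_ring V)"
  unfolding sr_ideal_def by (rule ideal_mon_ideal) (auto simp: simplicial_def keys_add_nat)

lemma mem_sr_ideal_iff:
  "f \<in> sr_ideal V D \<longleftrightarrow> f \<in> carrier (poly_ring V) \<and> (\<forall>e\<in>Poly_Mapping.keys f. Poly_Mapping.keys e \<notin> D)"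
  by (auto simp: sr_ideal_def mon_ideal_def)

text \<open>A squarefree monomial divides another monomial as soon as its support is contained in
  the support of the other. Membership of a monomial thus depends on its support alone, and the
  faces are the sets that contain no support of a generator.\<close>

lemma squarefree_imp_sr_ideal:
  assumes "squarefree_monomial_ideal V K"
  shows "\<exists>D. simplicial V D \<and> K = sr_ideal V D"
proof -
  obtain E where E: "\<And>e. e \<in> E \<Longrightarrow> Poly_Mapping.keys e \<subseteq> V"
      "\<And>e i. e \<in> E \<Longrightarrow> Poly_Mapping.lookup e i \<le> 1"
    and K: "K = Idl\<^bsub>poly_ring V\<^esub> (monomial ` E)"
    using assms unfolding squarefree_monomial_ideal_def by blast
  define D where "D = {F. F \<subseteq> V \<and> (\<forall>e\<in>E. \<not> Poly_Mapping.keys e \<subseteq> F)}"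
  have D: "simplicial V D"
    unfolding D_def simplicial_def by blast
  have gens: "monomial ` E \<subseteq> carrier (poly_ring V)"
    using E(1) by (auto intro: single_mem_poly_ring)
  have idl: "ideal K (poly_ring V)"
    unfolding K by (rule ring.genideal_ideal[OF ring_poly_ring gens])
  have sub: "monomial ` E \<subseteq> K"
    unfolding K by (rule ring.genideal_self[OF ring_poly_ring gens])
  have "K \<subseteq> sr_ideal V D"
    unfolding K using E(1)
    by (intro ring.genideal_minimal[OF ring_poly_ring ideal_sr_ideal[OF D]])
      (auto simp: sr_ideal_def D_def intro!: single_mem_mon_ideal)
  moreover have "sr_ideal V D \<subseteq> K"
    unfolding sr_ideal_def
  proof (rule mon_ideal_subset_ideal[OF idl])
    fix e :: "nat \<Rightarrow>\<^sub>0 nat" and c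
    assume "e \<in> {e. Poly_Mapping.keys e \<notin> D}" and V: "Poly_Mapping.keys e \<subseteq> V"
    then obtain g where g: "g \<in> E" "Poly_Mapping.keys g \<subseteq> Poly_Mapping.keys e"
      by (auto simp: D_def)
    have "Poly_Mapping.lookup g i \<le> Poly_Mapping.lookup e i" for i
      using E(2)[OF g(1), of i] g(2) by (cases "i \<in> Poly_Mapping.keys e") (auto simp: in_keys_iff)
    then obtain h where "e = g + h" "Poly_Mapping.keys h \<subseteq> Poly_Mapping.keys e"
      using exponent_le_imp_add by blast
    then show "Poly_Mapping.single e c \<in> K"
      using single_add_mem_ideal[OF idl, of g h c] sub g(1) V by blast
  qed
  ultimately show ?thesis using D by blast
qed

section \<open>Associated primes and symbolic powers of squarefree monomial ideals\<close>

text \<open>\<open>r\<close> sets the variables outside \<open>F\<close> to zero, which changes a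
  polynomial only by an element of the ideal. If \<open>f * g\<close> were in the ideal, so would be
  \<open>r f * r g\<close>; but this is a nonzero polynomial in the variables of
  \<open>F\<close>.\<close>

lemma keys_mult_sr_prime:
  fixes f g :: "'k::idom mpoly"
  assumes f: "f \<in> carrier (poly_ring V)" "f \<notin> sr_ideal V (Pow F)"
    and g: "g \<in> carrier (poly_ring V)" "g \<notin> sr_ideal V (Pow F)" and F: "F \<subseteq> V"
  shows "f * g \<notin> sr_ideal V (Pow F)"
proof
  let ?P = "sr_ideal V (Pow F) :: 'k mpoly set"
  define r where "r h = (\<Sum>e\<in>{e \<in> Poly_Mapping.keys h. Poly_Mapping.keys e \<subseteq> F}.
    Poly_Mapping.single e (Poly_Mapping.lookup h e))" for h :: "'k mpoly"
  have lookup_r: "Poly_Mapping.lookup (r h) e =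
      (if Poly_Mapping.keys e \<subseteq> F then Poly_Mapping.lookup h e else 0)" for h e
    by (auto simp: r_def lookup_sum lookup_single when_def not_in_keys_iff_lookup_eq_zero)
  have keys_r: "Poly_Mapping.keys (r h) = {e \<in> Poly_Mapping.keys h. Poly_Mapping.keys e \<subseteq> F}" for h
    using lookup_r[of h] by (auto simp: in_keys_iff[of _ "r h"] in_keys_iff[of _ h] split: if_splits)
  have idl: "ideal ?P (poly_ring V)"
    by (rule ideal_sr_ideal) (rule simplicial_Pow[OF F])
  have r_carrier: "r h \<in> carrier (poly_ring V)" if "h \<in> carrier (poly_ring V)" for h
    using that by (auto simp: mem_poly_ring_iff keys_r)
  have diff: "r h - h \<in> ?P" if "h \<in> carrier (poly_ring V)" for h
    using that by (auto simp: mem_sr_ideal_iff mem_poly_ring_iff in_keys_iff[of _ "r h - h"]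
        in_keys_iff[of _ h] lookup_minus lookup_r split: if_splits)
  have nz: "r h \<noteq> 0" if "h \<in> carrier (poly_ring V)" "h \<notin> ?P" for h
    using that keys_r[of h] by (auto simp: mem_sr_ideal_iff)
  assume "f * g \<in> ?P"
  moreover have "r f * r g = f * g + ((r f - f) * r g + f * (r g - g))"
    by (simp add: algebra_simps)
  ultimately have "r f * r g \<in> ?P"
    using ideal_poly_ringD[OF idl] diff f(1) g(1) r_carrier by metis
  moreover have "r f * r g \<noteq> 0"
    using nz f g by auto
  then obtain e where "e \<in> Poly_Mapping.keys (r f * r g)"
    by (metis all_not_in_conv keys_eq_empty)
  moreover from this have "Poly_Mapping.keys e \<subseteq> F"
    using keys_mult[of "r f" "r g"] by (force simp: keys_r keys_add_nat)
  ultimately show False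
    by (auto simp: mem_sr_ideal_iff)
qed

lemma primeideal_sr_ideal_Pow:
  assumes "F \<subseteq> V"
  shows "primeideal (sr_ideal V (Pow F) :: 'k::idom mpoly set) (poly_ring V)"
proof (rule primeidealI)
  show "ideal (sr_ideal V (Pow F) :: 'k mpoly set) (poly_ring V)"
    by (rule ideal_sr_ideal) (rule simplicial_Pow[OF assms])
  have "1 \<in> carrier (poly_ring V) - (sr_ideal V (Pow F) :: 'k mpoly set)"
    by (simp add: mem_sr_ideal_iff mem_poly_ring_iff)
  then show "carrier (poly_ring V) \<noteq> (sr_ideal V (Pow F) :: 'k mpoly set)"
    by blast
  fix f g :: "'k mpoly"
  assume "f \<in> carrier (poly_ring V)" "g \<in> carrier (poly_ring V)"
    "f \<otimes>\<^bsub>poly_ring V\<^esub> g \<in> sr_ideal V (Pow F)"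
  then show "f \<in> sr_ideal V (Pow F) \<or> g \<in> sr_ideal V (Pow F)"
    using keys_mult_sr_prime[OF _ _ _ _ assms] by auto
qed (rule cring_poly_ring)

text \<open>A complex is the union of the simplices on its faces. The void complex is excluded
  because the intersection over it is \<open>UNIV\<close> and not the carrier.\<close>

lemma sr_ideal_eq_Inter:
  assumes "simplicial V D" "D \<noteq> {}"
  shows "(sr_ideal V D :: 'k::comm_ring_1 mpoly set) = (\<Inter>F\<in>D. sr_ideal V (Pow F))"
proof (rule Set.set_eqI)
  fix f :: "'k mpoly"
  have "G \<in> D \<longleftrightarrow> (\<exists>F\<in>D. G \<in> Pow F)" for G
    using assms(1) unfolding simplicial_def by blast
  then show "f \<in> sr_ideal V D \<longleftrightarrow> f \<in> (\<Inter>F\<in>D. sr_ideal V (Pow F))"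
    using assms(2) unfolding INT_iff mem_sr_ideal_iff by blast
qed

text \<open>The colon ideal by \<open>f\<close> is the intersection of the face primes that do not
  contain \<open>f\<close>, namely those indexed by \<open>G\<close>. Being prime, it contains one
  of these face primes, and it is contained in each of them.\<close>

lemma Ass_sr_idealD:
  fixes P :: "'k::idom mpoly set"
  assumes D: "simplicial V D" and V: "finite V" and P: "P \<in> Ass (poly_ring V) (sr_ideal V D)"
  shows "\<exists>F\<in>D. P = sr_ideal V (Pow F)"
proof -
  obtain f where prime: "primeideal P (poly_ring V)" and f: "f \<in> carrier (poly_ring V)"
    and P_eq: "P = {r \<in> carrier (poly_ring V). r * f \<in> sr_ideal V D}"
    using P unfolding Ass_def by auto
  have idl: "ideal P (poly_ring V)" using prime by (rule primeideal.axioms)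
  have one: "1 \<notin> P"
    using ideal.one_imp_carrier[OF idl] primeideal.I_notcarr[OF prime] by auto
  define G where "G = {F \<in> D. f \<notin> sr_ideal V (Pow F)}"
  have P_iff: "r \<in> P \<longleftrightarrow> (\<forall>F\<in>G. r \<in> sr_ideal V (Pow F))" if r: "r \<in> carrier (poly_ring V)" for r
  proof -
    have "r * f \<in> sr_ideal V D \<longleftrightarrow> (\<forall>F\<in>D. r * f \<in> sr_ideal V (Pow F))"
    proof (cases "D = {}")
      case True
      then show ?thesis using mult_mem_poly_ring[OF r f] by (simp add: mem_sr_ideal_iff)
    next
      case False
      then show ?thesis by (simp add: sr_ideal_eq_Inter[OF D])
    qed
    also have "\<dots> \<longleftrightarrow> (\<forall>F\<in>G. r \<in> sr_ideal V (Pow F))"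
    proof -
      have "r * f \<in> sr_ideal V (Pow F) \<longleftrightarrow> r \<in> sr_ideal V (Pow F) \<or> f \<in> sr_ideal V (Pow F)"
        if "F \<in> D" for F
      proof -
        have FV: "F \<subseteq> V" using D that by (simp add: simplicial_def)
        have idl: "ideal (sr_ideal V (Pow F) :: 'k mpoly set) (poly_ring V)"
          by (rule ideal_sr_ideal) (rule simplicial_Pow[OF FV])
        show ?thesis
          using keys_mult_sr_prime[OF r _ f _ FV] ideal_poly_ringD(3)[OF idl _ r, of f]
            ideal_poly_ringD(4)[OF idl _ f, of r] by argo
      qed
      then show ?thesis by (auto simp: G_def)
    qed
    finally show ?thesis using r by (simp add: P_eq)
  qed
  define x where "x i = (monomial (Poly_Mapping.single i 1) :: 'k mpoly)" for i :: nat
  have x_carrier: "x i \<in> carrier (poly_ring V)" if "i \<in> V" for i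
    unfolding x_def using that by (intro single_mem_poly_ring) simp
  have prod_notin: "(\<Prod>i\<in>U. x i) \<in> carrier (poly_ring V) - P"
    if "finite U" "U \<subseteq> V" "\<And>i. i \<in> U \<Longrightarrow> x i \<notin> P" for U
    using that
  proof (induction U rule: finite_induct)
    case empty
    then show ?case using one by (simp add: mem_poly_ring_iff)
  next
    case (insert i U)
    then show ?case
      using primeideal.I_prime[OF prime, of "x i" "\<Prod>i\<in>U. x i"] x_carrier[of i]
        mult_mem_poly_ring[of "x i" V "\<Prod>i\<in>U. x i"]
      by auto
  qed
  have "\<exists>F\<in>G. \<forall>i\<in>V - F. x i \<in> P"
  proof (rule ccontr)
    \<comment> \<open>If every face in \<open>G\<close> misses a variable outside \<open>P\<close>,
      the product of all variables outside \<open>P\<close> lies in every face prime of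
      \<open>G\<close>, hence in \<open>P\<close>, against primality.\<close>
    define U where "U = {i \<in> V. x i \<notin> P}"
    assume "\<not> (\<exists>F\<in>G. \<forall>i\<in>V - F. x i \<in> P)"
    then have U: "F \<in> G \<Longrightarrow> \<exists>i\<in>U. i \<notin> F" for F
      by (auto simp: U_def)
    have "finite U" "U \<subseteq> V" using V by (auto simp: U_def)
    from prod_notin[OF this] have notin: "(\<Prod>i\<in>U. x i) \<in> carrier (poly_ring V) - P"
      by (auto simp: U_def)
    moreover have "(\<Prod>i\<in>U. x i) \<in> sr_ideal V (Pow F)" if "F \<in> G" for F
    proof -
      obtain i where i: "i \<in> U" "i \<notin> F" using U[OF \<open>F \<in> G\<close>] by blast
      have "F \<subseteq> V" using that D by (simp add: G_def simplicial_def)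
      then have idl': "ideal (sr_ideal V (Pow F) :: 'k mpoly set) (poly_ring V)"
        by (intro ideal_sr_ideal simplicial_Pow)
      have "x i \<in> sr_ideal V (Pow F)"
        using x_carrier[of i] i \<open>U \<subseteq> V\<close> by (auto simp: mem_sr_ideal_iff x_def)
      moreover have "(\<Prod>i\<in>U - {i}. x i) \<in> carrier (poly_ring V) - P"
        by (rule prod_notin) (use \<open>finite U\<close> in \<open>simp_all add: U_def subset_iff\<close>)
      ultimately have "x i * (\<Prod>i\<in>U - {i}. x i) \<in> sr_ideal V (Pow F)"
        using ideal_poly_ringD(4)[OF idl'] by blast
      then show ?thesis
        using prod.remove[OF \<open>finite U\<close> i(1), of x] by simp
    qed
    ultimately show False using P_iff by auto
  qed
  then obtain F where F: "F \<in> G" "\<And>i. i \<in> V - F \<Longrightarrow> x i \<in> P" by blast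
  have "sr_ideal V (Pow F) \<subseteq> P"
    unfolding sr_ideal_def
  proof (rule mon_ideal_subset_ideal[OF idl])
    fix e :: "nat \<Rightarrow>\<^sub>0 nat" and c assume "e \<in> {e. Poly_Mapping.keys e \<notin> Pow F}" and eV: "Poly_Mapping.keys e \<subseteq> V"
    then obtain i where i: "i \<in> Poly_Mapping.keys e" "i \<in> V - F" by auto
    then obtain h where h: "e = Poly_Mapping.single i 1 + h" "Poly_Mapping.keys h \<subseteq> Poly_Mapping.keys e"
      using split_variable[OF i(1)] by blast
    then show "Poly_Mapping.single e c \<in> P"
      using single_add_mem_ideal[OF idl, of "Poly_Mapping.single i 1" h c] F(2)[OF i(2)] eV
      unfolding x_def by blast
  qed
  moreover have "P \<subseteq> sr_ideal V (Pow F)"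
    using P_iff F(1) by (auto simp: P_eq)
  ultimately show ?thesis using F(1) by (auto simp: G_def)
qed

lemma ex_indicator_exponent:
  assumes "finite F" "k > 0"
  shows "\<exists>e :: nat \<Rightarrow>\<^sub>0 nat. Poly_Mapping.keys e = F \<and> (\<forall>i\<in>F. Poly_Mapping.lookup e i = k)"
proof -
  define e where "e = Abs_poly_mapping (\<lambda>i. if i \<in> F then k else 0)"
  have "Poly_Mapping.lookup e = (\<lambda>i. if i \<in> F then k else 0)"
    unfolding e_def using assms by (intro Abs_poly_mapping_inverse) (auto elim: finite_subset[rotated])
  then show ?thesis using assms by (intro exI[of _ e]) (auto simp: in_keys_iff split: if_splits)
qed

text \<open>The witness is the product of the variables in \<open>F\<close>: as \<open>F\<close> is
  maximal, a support together with \<open>F\<close> forms a face only if it lies inside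
  \<open>F\<close>.\<close>

lemma facet_ideal_in_Ass:
  assumes D: "simplicial V D" and V: "finite V" and F: "F \<in> D"
    and max: "\<And>G. \<lbrakk>G \<in> D; F \<subseteq> G\<rbrakk> \<Longrightarrow> G = F"
  shows "(sr_ideal V (Pow F) :: 'k::idom mpoly set) \<in> Ass (poly_ring V) (sr_ideal V D)"
proof -
  have FV: "F \<subseteq> V" using D F by (simp add: simplicial_def)
  then obtain g :: "nat \<Rightarrow>\<^sub>0 nat" where g: "Poly_Mapping.keys g = F"
    using ex_indicator_exponent[of F 1] V finite_subset by auto
  have eq: "sr_ideal V (Pow F) = {r \<in> carrier (poly_ring V). r * monomial g \<in> (sr_ideal V D :: 'k mpoly set)}"
  proof -
    have "Poly_Mapping.keys e \<union> F \<in> D \<longleftrightarrow> Poly_Mapping.keys e \<subseteq> F" for e :: "nat \<Rightarrow>\<^sub>0 nat"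
      using max[of "Poly_Mapping.keys e \<union> F"] F by (auto simp: Un_absorb1)
    moreover have "(monomial g :: 'k mpoly) \<in> carrier (poly_ring V)"
      using g FV by (intro single_mem_poly_ring) simp
    ultimately show ?thesis
      by (auto simp: mem_sr_ideal_iff keys_mult_single keys_add_nat g mult_mem_poly_ring)
  qed
  have "monomial g \<in> carrier (poly_ring V)"
    using g FV by (intro single_mem_poly_ring) simp
  then show ?thesis
    unfolding Ass_def using primeideal_sr_ideal_Pow[OF FV, where ?'k = 'k] eq by auto
qed

lemma ex_facet:
  assumes D: "simplicial V D" and V: "finite V" and F: "F \<in> D"
  shows "\<exists>G\<in>D. F \<subseteq> G \<and> (\<forall>H\<in>D. G \<subseteq> H \<longrightarrow> H = G)"
proof -
  have "D \<subseteq> Pow V" using D by (auto simp: simplicial_def)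
  then have "finite D" using V by (simp add: finite_subset)
  from finite_has_maximal2[OF this F] show ?thesis by auto
qed

section \<open>Powers of face primes and symbolic powers\<close>

lemma ideal_pow_sr_ideal_Pow:
  assumes F: "F \<subseteq> V" and V: "finite V"
  shows "ideal_pow (poly_ring V) (sr_ideal V (Pow F) :: 'k::idom mpoly set) s =
    mon_ideal V {e. s \<le> (\<Sum>i\<in>V - F. Poly_Mapping.lookup e i)}" (is "?I s = ?J s")
proof (induction s)
  case 0
  then show ?case by (simp add: mon_ideal_def)
next
  case (Suc s)
  let ?P = "sr_ideal V (Pow F) :: 'k mpoly set"
  let ?R = "poly_ring V :: 'k mpoly ring"
  have idlP: "ideal ?P ?R" by (intro ideal_sr_ideal simplicial_Pow F)
  have idlJ: "ideal (?J t) ?R" for t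
    by (rule ideal_mon_ideal) (auto simp: lookup_add sum.distrib)
  have "ideal_prod ?R ?P (?J s) \<subseteq> ?J (Suc s)"
  proof
    fix f assume "f \<in> ideal_prod ?R ?P (?J s)"
    then show "f \<in> ?J (Suc s)"
    proof induction
      case (prod f g)
      have "Suc s \<le> (\<Sum>i\<in>V - F. Poly_Mapping.lookup e i)" if e: "e \<in> Poly_Mapping.keys (f * g)" for e
      proof -
        obtain a b where ab: "e = a + b" "a \<in> Poly_Mapping.keys f" "b \<in> Poly_Mapping.keys g"
          using keys_mult[of f g] e by blast
        have "Poly_Mapping.keys a \<subseteq> V" "\<not> Poly_Mapping.keys a \<subseteq> F"
          using prod(1) ab(2) by (simp_all add: mem_sr_ideal_iff mem_poly_ring_iff)
        then obtain i where "i \<in> Poly_Mapping.keys a" "i \<in> V - F" by blast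
        then have "i \<in> V - F" "Poly_Mapping.lookup a i > 0" by (simp_all add: in_keys_iff)
        then have "1 \<le> (\<Sum>i\<in>V - F. Poly_Mapping.lookup a i)"
          using V member_le_sum[of i "V - F" "Poly_Mapping.lookup a"] by auto
        moreover have "s \<le> (\<Sum>i\<in>V - F. Poly_Mapping.lookup b i)"
          using prod(2) ab by (auto simp: mon_ideal_def)
        ultimately show ?thesis by (simp add: ab lookup_add sum.distrib)
      qed
      moreover have "f * g \<in> carrier ?R"
        using prod by (auto simp: mem_sr_ideal_iff mon_ideal_def intro: mult_mem_poly_ring)
      ultimately show ?case by (auto simp: mon_ideal_def)
    next
      case (sum f g)
      then show ?case using ideal_poly_ringD(2)[OF idlJ] by simp
    qed
  qed
  moreover have "?J (Suc s) \<subseteq> ideal_prod ?R ?P (?J s)"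
  proof (rule mon_ideal_subset_ideal[OF ring.ideal_prod_is_ideal[OF ring_poly_ring idlP idlJ]])
    fix e :: "nat \<Rightarrow>\<^sub>0 nat" and c assume "e \<in> {e. Suc s \<le> (\<Sum>i\<in>V - F. Poly_Mapping.lookup e i)}"
      and eV: "Poly_Mapping.keys e \<subseteq> V"
    then have e: "Suc s \<le> (\<Sum>i\<in>V - F. Poly_Mapping.lookup e i)" by simp
    then obtain i where i: "i \<in> V - F" "Poly_Mapping.lookup e i \<noteq> 0"
      by (metis Suc_leD not_less_eq_eq sum.neutral zero_le)
    then obtain h where h: "e = Poly_Mapping.single i 1 + h" "Poly_Mapping.keys h \<subseteq> Poly_Mapping.keys e"
      using split_variable[of i e] by (auto simp: in_keys_iff)
    have "(\<Sum>j\<in>V - F. Poly_Mapping.lookup (Poly_Mapping.single i 1 :: nat \<Rightarrow>\<^sub>0 nat) j) = 1"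
      using i V by (simp add: lookup_single when_def)
    then have "s \<le> (\<Sum>i\<in>V - F. Poly_Mapping.lookup h i)"
      using e by (simp add: h lookup_add sum.distrib)
    then have "Poly_Mapping.single h c \<in> ?J s"
      using h eV by (intro single_mem_mon_ideal) auto
    moreover have "monomial (Poly_Mapping.single i 1) \<in> ?P"
      using i by (auto simp: mem_sr_ideal_iff mem_poly_ring_iff)
    ultimately have "monomial (Poly_Mapping.single i 1) \<otimes>\<^bsub>?R\<^esub> Poly_Mapping.single h c \<in> ideal_prod ?R ?P (?J s)"
      by (intro ideal_prod.prod)
    then show "Poly_Mapping.single e c \<in> ideal_prod ?R ?P (?J s)"
      by (simp add: mult_single h)
  qed
  ultimately show ?case by (simp add: Suc)
qed

text \<open>The associated primes lie between the facet primes and the face primes. Both families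
  define the same ideal: for a smaller face the sum runs over more variables, so the condition at a
  facet implies those at all its subfaces.\<close>

lemma symbolic_power_sr_ideal:
  assumes D: "simplicial V D" and V: "finite V"
  shows "symbolic_power (poly_ring V) (sr_ideal V D :: 'k::idom mpoly set) s =
    mon_ideal V {e. \<forall>F\<in>D. s \<le> (\<Sum>i\<in>V - F. Poly_Mapping.lookup e i)}"
proof -
  have sub: "F \<subseteq> V" if "F \<in> D" for F using D that by (simp add: simplicial_def)
  show ?thesis
  proof (intro equalityI subsetI)
    fix f assume f: "f \<in> symbolic_power (poly_ring V) (sr_ideal V D :: 'k mpoly set) s"
    have "s \<le> (\<Sum>i\<in>V - F. Poly_Mapping.lookup e i)" if F: "F \<in> D" and e: "e \<in> Poly_Mapping.keys f" for e F
    proof -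
      from ex_facet[OF D V F] obtain G where G: "G \<in> D"
        and G': "F \<subseteq> G \<and> (\<forall>H\<in>D. G \<subseteq> H \<longrightarrow> H = G)"
        by (rule bexE)
      have "(sr_ideal V (Pow G) :: 'k mpoly set) \<in> Ass (poly_ring V) (sr_ideal V D)"
        by (rule facet_ideal_in_Ass[OF D V G]) (use G' in simp)
      then have "f \<in> ideal_pow (poly_ring V) (sr_ideal V (Pow G)) s"
        using f by (auto simp: symbolic_power_def)
      then have "f \<in> mon_ideal V {e. s \<le> (\<Sum>i\<in>V - G. Poly_Mapping.lookup e i)}"
        by (simp add: ideal_pow_sr_ideal_Pow[OF sub[OF G] V])
      then have "s \<le> (\<Sum>i\<in>V - G. Poly_Mapping.lookup e i)"
        using e by (auto simp: mon_ideal_def)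
      also have "\<dots> \<le> (\<Sum>i\<in>V - F. Poly_Mapping.lookup e i)"
        using G' V by (intro sum_mono2) auto
      finally show ?thesis .
    qed
    then show "f \<in> mon_ideal V {e. \<forall>F\<in>D. s \<le> (\<Sum>i\<in>V - F. Poly_Mapping.lookup e i)}"
      using f by (auto simp: mon_ideal_def symbolic_power_def)
  next
    fix f :: "'k mpoly"
    assume f: "f \<in> mon_ideal V {e. \<forall>F\<in>D. s \<le> (\<Sum>i\<in>V - F. Poly_Mapping.lookup e i)}"
    have "f \<in> ideal_pow (poly_ring V) P s" if P: "P \<in> Ass (poly_ring V) (sr_ideal V D)" for P
    proof -
      obtain F where "F \<in> D" "P = sr_ideal V (Pow F)"
        using Ass_sr_idealD[OF D V P] by blast
      then show ?thesis
        using f by (auto simp: ideal_pow_sr_ideal_Pow[OF sub V] mon_ideal_def)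
    qed
    then show "f \<in> symbolic_power (poly_ring V) (sr_ideal V D) s"
      using f by (auto simp: symbolic_power_def mon_ideal_def)
  qed
qed

section \<open>The complex of \<open>I + J + mn\<close>\<close>

lemma set_add_mono_ideal:
  assumes "ideal L (poly_ring V)" "A \<subseteq> L" "B \<subseteq> L"
  shows "A <+>\<^bsub>poly_ring V\<^esub> B \<subseteq> L"
  using ideal_poly_ringD(2)[OF assms(1)] assms(2,3) by (auto simp: set_add_def set_mult_def)

lemma subset_set_add:
  assumes "ideal A (poly_ring V)" "ideal B (poly_ring V)"
  shows "A \<subseteq> A <+>\<^bsub>poly_ring V\<^esub> B" "B \<subseteq> A <+>\<^bsub>poly_ring V\<^esub> B"
  using ideal_poly_ringD(1)[OF assms(1)] ideal_poly_ringD(1)[OF assms(2)]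
  by (force simp: set_add_def set_mult_def)+

lemma max_hom_ideal_subset: "max_hom_ideal U \<subseteq> sr_ideal U {{}}"
  unfolding max_hom_ideal_def
  by (rule ring.genideal_minimal[OF ring_poly_ring ideal_sr_ideal])
    (auto simp: simplicial_def mem_sr_ideal_iff mem_poly_ring_iff)

lemma variable_mem_max_hom_ideal:
  assumes "i \<in> U"
  shows "monomial (Poly_Mapping.single i 1) \<in> max_hom_ideal U"
proof -
  have "(\<lambda>i. monomial (Poly_Mapping.single i 1)) ` U \<subseteq> carrier (poly_ring U)"
    by (auto simp: mem_poly_ring_iff)
  from ring.genideal_self[OF ring_poly_ring this] show ?thesis
    using assms by (auto simp: max_hom_ideal_def)
qed

text \<open>A monomial with variables from both blocks is divisible by a generator of
  \<open>mn\<close>, and one supported in a single block is decided by the ideal of that block. The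
  empty face must be in both complexes: a nonface of \<open>D1\<close> inside \<open>M\<close> that
  is a face of \<open>D2\<close> could only be the empty set.\<close>

lemma fiber_ideal_sr_ideal:
  fixes m n :: nat
  assumes D1: "simplicial {1..m} D1" "{} \<in> D1" and D2: "simplicial {m+1..n} D2" "{} \<in> D2"
    and mn: "m \<le> n"
  shows "fiber_ideal m n (sr_ideal {1..m} D1 :: 'k::comm_ring_1 mpoly set) (sr_ideal {m+1..n} D2) =
    sr_ideal {1..n} (D1 \<union> D2)"
proof -
  define M N V where "M = {1..m}" "N = {m+1..n}" "V = {1..n}"
  have sub: "M \<subseteq> V" "N \<subseteq> V" and V: "V = M \<union> N" and disj: "M \<inter> N = {}"
    using mn by (auto simp: M_N_V_def)
  note D1 = D1[folded M_N_V_def] and D2 = D2[folded M_N_V_def]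
  define S where "S = (poly_ring V :: 'k mpoly ring)"
  define I J A B :: "'k mpoly set" where "I = sr_ideal M D1" "J = sr_ideal N D2"
    "A = max_hom_ideal M" "B = max_hom_ideal N"
  note defs = I_J_A_B_def
  interpret S: ring S unfolding S_def by (rule ring_poly_ring)
  have D1M: "F \<subseteq> M" if "F \<in> D1" for F using D1 that by (simp add: simplicial_def)
  have D2N: "F \<subseteq> N" if "F \<in> D2" for F using D2 that by (simp add: simplicial_def)
  have D: "simplicial V (D1 \<union> D2)"
    unfolding simplicial_def
  proof
    fix F assume "F \<in> D1 \<union> D2"
    then show "F \<subseteq> V \<and> Pow F \<subseteq> D1 \<union> D2"
    proof
      assume "F \<in> D1"
      then have "F \<subseteq> M" "Pow F \<subseteq> D1" using D1 by (simp_all add: simplicial_def)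
      then show ?thesis using sub by blast
    next
      assume "F \<in> D2"
      then have "F \<subseteq> N" "Pow F \<subseteq> D2" using D2 by (simp_all add: simplicial_def)
      then show ?thesis using sub by blast
    qed
  qed
  define T where "T = (sr_ideal V (D1 \<union> D2) :: 'k mpoly set)"
  have idlT: "ideal T S" unfolding T_def S_def by (rule ideal_sr_ideal[OF D])
  have sr_sub: "sr_ideal U E \<subseteq> carrier S" if "U \<subseteq> V" for U E
    using poly_ring_mono[OF that] by (auto simp: sr_ideal_def S_def mon_ideal_def)
  have carr: "I \<subseteq> carrier S" "J \<subseteq> carrier S" "A \<subseteq> carrier S" "B \<subseteq> carrier S"
    using sr_sub sub max_hom_ideal_subset unfolding defs by blast+
  note idl = S.genideal_ideal[OF carr(1)] S.genideal_ideal[OF carr(2)]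
    S.genideal_ideal[OF carr(3)] S.genideal_ideal[OF carr(4)]
  define P where "P = ideal_prod S (Idl\<^bsub>S\<^esub> A) (Idl\<^bsub>S\<^esub> B)"
  have idlP: "ideal P S" unfolding P_def by (rule S.ideal_prod_is_ideal[OF idl(3,4)])
  have idlIJ: "ideal (Idl\<^bsub>S\<^esub> I <+>\<^bsub>S\<^esub> Idl\<^bsub>S\<^esub> J) S" by (rule S.add_ideals[OF idl(1,2)])
  define L where "L = (Idl\<^bsub>S\<^esub> I <+>\<^bsub>S\<^esub> Idl\<^bsub>S\<^esub> J) <+>\<^bsub>S\<^esub> P"
  have idlL: "ideal L S" unfolding L_def by (rule S.add_ideals[OF idlIJ idlP])
  have "L \<subseteq> T"
  proof -
    have "I \<subseteq> T"
    proof
      fix f assume f: "f \<in> I"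
      have "Poly_Mapping.keys e \<notin> D1 \<union> D2" if "e \<in> Poly_Mapping.keys f" for e
      proof -
        have "Poly_Mapping.keys e \<subseteq> M" "Poly_Mapping.keys e \<notin> D1"
          using f that by (simp_all add: defs mem_sr_ideal_iff mem_poly_ring_iff)
        then show ?thesis using D2N[of "Poly_Mapping.keys e"] D1(2) disj by (metis Un_iff inf.order_iff inf_mono order_refl subset_empty)
      qed
      then show "f \<in> T" using f carr(1) by (auto simp: T_def mem_sr_ideal_iff S_def)
    qed
    moreover have "J \<subseteq> T"
    proof
      fix f assume f: "f \<in> J"
      have "Poly_Mapping.keys e \<notin> D1 \<union> D2" if "e \<in> Poly_Mapping.keys f" for e
      proof -
        have "Poly_Mapping.keys e \<subseteq> N" "Poly_Mapping.keys e \<notin> D2"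
          using f that by (simp_all add: defs mem_sr_ideal_iff mem_poly_ring_iff)
        then show ?thesis using D1M[of "Poly_Mapping.keys e"] D2(2) disj by (metis Un_iff inf.order_iff inf_mono order_refl subset_empty)
      qed
      then show "f \<in> T" using f carr(2) by (auto simp: T_def mem_sr_ideal_iff S_def)
    qed
    moreover have "P \<subseteq> T"
    proof -
      \<comment> \<open>With \<open>U = M\<close>, \<open>U' = N\<close> and with the roles swapped,
        this puts \<open>m\<close> into the prime of the variables off \<open>N\<close> and
        \<open>n\<close> into that of the variables off \<open>M\<close>. Their product lies in
        both, and a support contained in neither block is no face.\<close>
      have out: "(sr_ideal U {{}} :: 'k mpoly set) \<subseteq> sr_ideal V (Pow U')" if "U \<subseteq> V" "U \<inter> U' = {}" for U U'
      proof
        fix f :: "'k mpoly" assume f: "f \<in> sr_ideal U {{}}"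
        have "\<not> Poly_Mapping.keys e \<subseteq> U'" if "e \<in> Poly_Mapping.keys f" for e
        proof -
          have "Poly_Mapping.keys e \<subseteq> U" "Poly_Mapping.keys e \<noteq> {}"
            using f that by (simp_all add: mem_sr_ideal_iff mem_poly_ring_iff)
          then show ?thesis using \<open>U \<inter> U' = {}\<close> by blast
        qed
        then show "f \<in> sr_ideal V (Pow U')"
          using f poly_ring_mono[OF \<open>U \<subseteq> V\<close>] by (auto simp: mem_sr_ideal_iff)
      qed
      have "A \<subseteq> sr_ideal V (Pow N)" "B \<subseteq> sr_ideal V (Pow M)"
        using out[of M N] out[of N M] sub disj max_hom_ideal_subset unfolding defs by blast+
      then have "Idl\<^bsub>S\<^esub> A \<subseteq> sr_ideal V (Pow N)" "Idl\<^bsub>S\<^esub> B \<subseteq> sr_ideal V (Pow M)"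
        using S.genideal_minimal ideal_sr_ideal[OF simplicial_Pow] sub unfolding S_def by blast+
      then have "P \<subseteq> sr_ideal V (Pow N) \<inter> sr_ideal V (Pow M)"
        using S.ideal_prod_inter[OF idl(3,4)] unfolding P_def by blast
      also have "\<dots> \<subseteq> T"
        using D1M D2N unfolding T_def subset_iff Int_iff mem_sr_ideal_iff by blast
      finally show ?thesis .
    qed
    ultimately show ?thesis
      unfolding L_def S_def
      using set_add_mono_ideal[OF idlT[unfolded S_def]] S.genideal_minimal[OF idlT, unfolded S_def]
      by simp
  qed
  moreover have "T \<subseteq> L"
    unfolding T_def sr_ideal_def
  proof (rule mon_ideal_subset_ideal[OF idlL[unfolded S_def]])
    fix e :: "nat \<Rightarrow>\<^sub>0 nat" and c :: 'k
    assume "e \<in> {e. Poly_Mapping.keys e \<notin> D1 \<union> D2}" and eV: "Poly_Mapping.keys e \<subseteq> V"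
    then have e: "Poly_Mapping.keys e \<notin> D1" "Poly_Mapping.keys e \<notin> D2" by auto
    have subL: "I \<subseteq> L" "J \<subseteq> L" "P \<subseteq> L"
      using subset_set_add[OF idl(1,2)[unfolded S_def]] S.genideal_self[OF carr(1)] S.genideal_self[OF carr(2)]
        subset_set_add[OF idlIJ[unfolded S_def] idlP[unfolded S_def]]
      unfolding L_def S_def by blast+
    consider "Poly_Mapping.keys e \<subseteq> M" | "Poly_Mapping.keys e \<subseteq> N"
      | "\<not> Poly_Mapping.keys e \<subseteq> M" "\<not> Poly_Mapping.keys e \<subseteq> N" by blast
    then show "Poly_Mapping.single e c \<in> L"
    proof cases
      case 1
      then have "Poly_Mapping.single e c \<in> I"
        using e by (auto simp: defs mem_sr_ideal_iff mem_poly_ring_iff)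
      then show ?thesis using subL by blast
    next
      case 2
      then have "Poly_Mapping.single e c \<in> J"
        using e by (auto simp: defs mem_sr_ideal_iff mem_poly_ring_iff)
      then show ?thesis using subL by blast
    next
      case 3
      then obtain i j where i: "i \<in> Poly_Mapping.keys e" "i \<in> M" and j: "j \<in> Poly_Mapping.keys e" "j \<in> N"
        using eV V by blast
      obtain h where h: "e = Poly_Mapping.single i 1 + h" "Poly_Mapping.keys h \<subseteq> Poly_Mapping.keys e"
        using split_variable[OF i(1)] by blast
      have "j \<in> Poly_Mapping.keys h"
        using j i disj unfolding h(1) by (auto simp: keys_add_nat)
      from split_variable[OF this] obtain h' where h':
        "h = Poly_Mapping.single j 1 + h'" "Poly_Mapping.keys h' \<subseteq> Poly_Mapping.keys h" by blast
      have "monomial (Poly_Mapping.single i 1) \<otimes>\<^bsub>S\<^esub> monomial (Poly_Mapping.single j 1) \<in> P"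
        unfolding P_def defs
        using variable_mem_max_hom_ideal[OF i(2)] variable_mem_max_hom_ideal[OF j(2)]
          S.genideal_self[OF carr(3)] S.genideal_self[OF carr(4)]
        by (intro ideal_prod.prod) (auto simp: defs)
      then have "monomial (Poly_Mapping.single i 1 + Poly_Mapping.single j 1) \<in> L"
        using subL by (auto simp: S_def mult_single)
      from single_add_mem_ideal[OF idlL[unfolded S_def] this, of h' c] show ?thesis
        using h h' eV by (simp add: add.assoc)
    qed
  qed
  ultimately show ?thesis
    unfolding fiber_ideal_def Let_def L_def P_def T_def S_def defs M_N_V_def by blast
qed

section \<open>The Cech complex in a fixed degree\<close>

lemma quot_module_simps:
  "carrier (quot_module R K) = carrier (R Quot K)" "\<zero>\<^bsub>quot_module R K\<^esub> = \<zero>\<^bsub>R Quot K\<^esub>"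
  "x \<oplus>\<^bsub>quot_module R K\<^esub> y = x \<oplus>\<^bsub>R Quot K\<^esub> y"
  "a \<odot>\<^bsub>quot_module R K\<^esub> x = (K +>\<^bsub>R\<^esub> a) \<otimes>\<^bsub>R Quot K\<^esub> x"
  by (simp_all add: quot_module_def)

lemma module_quot_module:
  assumes "cring R" "ideal K R"
  shows "module R (quot_module R K)"
proof -
  interpret R: cring R by fact
  interpret K: ideal K R by fact
  interpret Q: cring "R Quot K" by (rule K.quotient_is_cring[OF assms(1)])
  interpret h: ring_hom_ring R "R Quot K" "(+>\<^bsub>R\<^esub>) K" by (rule K.rcos_ring_hom_ring)
  show ?thesis
  proof (rule moduleI)
    show "abelian_group (quot_module R K)"
    proof (rule abelian_groupI)
      fix x assume "x \<in> carrier (quot_module R K)"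
      then show "\<exists>y\<in>carrier (quot_module R K). y \<oplus>\<^bsub>quot_module R K\<^esub> x = \<zero>\<^bsub>quot_module R K\<^esub>"
        unfolding quot_module_simps using Q.l_neg Q.a_inv_closed by blast
    qed (simp_all add: quot_module_simps Q.a_ac)
  qed (simp_all add: quot_module_simps Q.l_distr Q.r_distr Q.m_assoc assms(1) h.hom_one)
qed

section \<open>Combinatorial cochains with the signs of the Cech differential\<close>

definition cobd :: "(nat set \<Rightarrow> 'k::ab_group_add) \<Rightarrow> nat set \<Rightarrow> 'k" where
  "cobd c F = (\<Sum>i\<in>F. if even (card {j \<in> F. j < i}) then c (F - {i}) else - c (F - {i}))"

lemma cobd_zero [simp]: "cobd (\<lambda>_. 0) F = 0"
  by (auto simp: cobd_def intro!: sum.neutral)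

lemma cobd_add: "cobd (\<lambda>F. b F + c F) F = cobd b F + cobd c F"
  unfolding cobd_def sum.distrib[symmetric] by (rule sum.cong) auto

lemma cobd_minus: "cobd (\<lambda>F. b F - c F) F = cobd b F - cobd c F"
  unfolding cobd_def sum_subtractf[symmetric] by (rule sum.cong) auto

text \<open>Graded by cardinality, as the Cech complex is: position \<open>p\<close> holds the faces
  of dimension \<open>p - 1\<close>.\<close>

definition cochains :: "'k::ab_group_add itself \<Rightarrow> nat set set \<Rightarrow> nat \<Rightarrow> (nat set \<Rightarrow> 'k) set" where
  "cochains _ T p = {c. \<forall>F. c F \<noteq> 0 \<longrightarrow> F \<in> T \<and> card F = p}"

definition coboundaries :: "'k::ab_group_add itself \<Rightarrow> nat set set \<Rightarrow> nat \<Rightarrow> (nat set \<Rightarrow> 'k) set" where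
  "coboundaries k T p = (case p of 0 \<Rightarrow> {\<lambda>_. 0} | Suc q \<Rightarrow> cobd ` cochains k T q)"

text \<open>\<open>cobd\<close> of a cochain may be nonzero off \<open>T\<close>, where the Cech
  pieces vanish, so both conditions are tested on \<open>T\<close> only. \<open>T\<close> need not
  be closed under subsets: in a degree with negative entries all its faces contain the negative
  support.\<close>

definition nontrivial_cohomology :: "'k::ab_group_add itself \<Rightarrow> nat set set \<Rightarrow> nat \<Rightarrow> bool" where
  "nontrivial_cohomology k T p \<longleftrightarrow>
    (\<exists>c\<in>cochains k T p. (\<forall>F\<in>T. card F = Suc p \<longrightarrow> cobd c F = 0) \<and>
      \<not> (\<exists>b\<in>coboundaries k T p. \<forall>F\<in>T. card F = p \<longrightarrow> c F = b F))"

lemma zero_mem_coboundaries: "(\<lambda>_. 0) \<in> coboundaries k T p"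
  by (cases p) (auto simp: coboundaries_def cochains_def image_iff intro!: exI[of _ "\<lambda>_. 0"])

lemma coboundaries_add:
  assumes "a \<in> coboundaries k T p" "b \<in> coboundaries k T p"
  shows "(\<lambda>F. a F + b F) \<in> coboundaries k T p"
proof (cases p)
  case (Suc q)
  then obtain a' b' where ab: "a' \<in> cochains k T q" "b' \<in> cochains k T q" "a = cobd a'" "b = cobd b'"
    using assms by (auto simp: coboundaries_def)
  have "a' F \<noteq> 0 \<or> b' F \<noteq> 0" if "a' F + b' F \<noteq> 0" for F
    using that by auto
  then have "(\<lambda>F. a' F + b' F) \<in> cochains k T q"
    using ab(1,2) unfolding cochains_def by blast
  moreover have "(\<lambda>F. a F + b F) = cobd (\<lambda>F. a' F + b' F)"
    by (rule ext) (simp add: ab cobd_add)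
  ultimately show ?thesis by (simp add: Suc coboundaries_def)
qed (use assms in \<open>simp add: coboundaries_def\<close>)

lemma coboundaries_minus:
  assumes "a \<in> coboundaries k T p" "b \<in> coboundaries k T p"
  shows "(\<lambda>F. a F - b F) \<in> coboundaries k T p"
proof (cases p)
  case (Suc q)
  then obtain a' b' where ab: "a' \<in> cochains k T q" "b' \<in> cochains k T q" "a = cobd a'" "b = cobd b'"
    using assms by (auto simp: coboundaries_def)
  have "a' F \<noteq> 0 \<or> b' F \<noteq> 0" if "a' F - b' F \<noteq> 0" for F
    using that by auto
  then have "(\<lambda>F. a' F - b' F) \<in> cochains k T q"
    using ab(1,2) unfolding cochains_def by blast
  moreover have "(\<lambda>F. a F - b F) = cobd (\<lambda>F. a' F - b' F)"
    by (rule ext) (simp add: ab cobd_minus)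
  ultimately show ?thesis by (simp add: Suc coboundaries_def)
qed (use assms in \<open>simp add: coboundaries_def\<close>)

text \<open>Applied to \<gamma> this is the positive part of a degree, applied to the pointwise
  negation of \<gamma> the negative part.\<close>

definition pos_exponent :: "(nat \<Rightarrow> int) \<Rightarrow> (nat \<Rightarrow>\<^sub>0 nat)" where
  "pos_exponent \<gamma> = Abs_poly_mapping (\<lambda>i. nat (\<gamma> i))"

lemma lookup_pos_exponent:
  assumes "finite V" "\<And>i. i \<notin> V \<Longrightarrow> \<gamma> i = 0"
  shows "Poly_Mapping.lookup (pos_exponent \<gamma>) i = nat (\<gamma> i)"
proof -
  have "{i. nat (\<gamma> i) \<noteq> 0} \<subseteq> V"
    using assms(2) by force
  then have "finite {i. nat (\<gamma> i) \<noteq> 0}"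
    using assms(1) by (rule finite_subset)
  then show ?thesis by (simp add: pos_exponent_def Abs_poly_mapping_inverse)
qed

section \<open>The Cech strand of a monomial quotient in degree \<gamma>\<close>

locale monomial_quotient =
  fixes V :: "nat set" and X :: "(nat \<Rightarrow>\<^sub>0 nat) set" and \<gamma> :: "nat \<Rightarrow> int"
    and K :: "'k::comm_ring_1 mpoly set"
  assumes finite_V: "finite V"
    and X_add: "e \<in> X \<Longrightarrow> e + h \<in> X"
    and degree_V: "i \<notin> V \<Longrightarrow> \<gamma> i = 0"
    and K_eq: "K = mon_ideal V X"
begin

abbreviation "R \<equiv> poly_ring V :: 'k mpoly ring"
abbreviation "M \<equiv> quot_module R K"
abbreviation "Q f \<equiv> K +>\<^bsub>R\<^esub> f"
abbreviation "G \<equiv> quot_grading V K"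
abbreviation "Mon F \<equiv> monomials_on F :: 'k mpoly set"

text \<open>The sets \<open>F\<close> for which the piece of degree \<gamma> of the localization at
  \<open>F\<close> is nonzero: the negative part of \<gamma> is inverted, and no monomial in the
  variables of \<open>F\<close> carries the positive part into the ideal.\<close>

definition T :: "nat set set" where
  "T = {F. F \<subseteq> V \<and> {i. \<gamma> i < 0} \<subseteq> F \<and>
     (\<forall>h. Poly_Mapping.keys h \<subseteq> F \<longrightarrow> pos_exponent \<gamma> + h \<notin> X)}"

lemma ideal_K: "ideal K R"
  unfolding K_eq by (rule ideal_mon_ideal) (rule X_add)

sublocale M: module R M
  by (rule module_quot_module[OF cring_poly_ring ideal_K])

lemma module_localization_Mon: "F \<subseteq> V \<Longrightarrow> module_localization R M (Mon F)"
proof unfold_locales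
  assume F: "F \<subseteq> V"
  then show "Mon F \<subseteq> carrier R"
    by (auto simp: monomials_on_def intro!: single_mem_poly_ring)
  have "monomial 0 \<in> Mon F"
    unfolding monomials_on_def by (rule CollectI, rule exI[of _ 0]) simp
  then show "\<one>\<^bsub>R\<^esub> \<in> Mon F" by simp
  fix w z assume "w \<in> Mon F" "z \<in> Mon F"
  then obtain a b where "w = monomial a" "z = monomial b"
    "Poly_Mapping.keys a \<subseteq> F" "Poly_Mapping.keys b \<subseteq> F"
    by (auto simp: monomials_on_def)
  then show "w \<otimes>\<^bsub>R\<^esub> z \<in> Mon F"
    by (auto simp: monomials_on_def mult_single keys_add_nat intro!: exI[of _ "a + b"])
qed

lemma Q_closed [simp]: "f \<in> carrier R \<Longrightarrow> Q f \<in> carrier M"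
  using ideal.rcos_ring_hom[OF ideal_K] by (auto simp: quot_module_simps ring_hom_def)

lemma Q_add: "\<lbrakk>f \<in> carrier R; g \<in> carrier R\<rbrakk> \<Longrightarrow> Q f \<oplus>\<^bsub>M\<^esub> Q g = Q (f + g)"
  using ring_hom_add[OF ideal.rcos_ring_hom[OF ideal_K], of f g] by (simp add: quot_module_simps)

lemma smult_Q: "\<lbrakk>f \<in> carrier R; g \<in> carrier R\<rbrakk> \<Longrightarrow> f \<odot>\<^bsub>M\<^esub> Q g = Q (f * g)"
  using ring_hom_mult[OF ideal.rcos_ring_hom[OF ideal_K], of f g] by (simp add: quot_module_simps)

lemma Q_eq_iff: "\<lbrakk>f \<in> carrier R; g \<in> carrier R\<rbrakk> \<Longrightarrow> Q f = Q g \<longleftrightarrow> f - g \<in> K"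
  using ring.quotient_eq_iff_same_a_r_cos[OF ring_poly_ring ideal_K, of f g]
  by (simp add: a_minus_def minus_poly_ring)

lemma zero_M: "\<zero>\<^bsub>M\<^esub> = Q 0"
  using abelian_group.a_coset_add_zero[of R K] ideal.axioms(1)[OF ideal_K] M.R.abelian_group_axioms
    additive_subgroup.a_subset[of K R]
  by (simp add: quot_module_simps FactRing_def)

lemma lookup_pos: "Poly_Mapping.lookup (pos_exponent \<gamma>) i = nat (\<gamma> i)"
  by (rule lookup_pos_exponent[OF finite_V degree_V])

lemma lookup_neg: "Poly_Mapping.lookup (pos_exponent (\<lambda>i. - \<gamma> i)) i = nat (- \<gamma> i)"
  by (rule lookup_pos_exponent[OF finite_V]) (simp add: degree_V)

lemma keys_neg: "Poly_Mapping.keys (pos_exponent (\<lambda>i. - \<gamma> i)) = {i. \<gamma> i < 0}"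
  by (auto simp: in_keys_iff lookup_neg)

lemma keys_pos: "Poly_Mapping.keys (pos_exponent \<gamma>) \<subseteq> V"
  using degree_V by (force simp: in_keys_iff lookup_pos)

text \<open>The piece of degree \<open>\<gamma>\<close> of the localization at \<open>F\<close> is spanned by the fraction \<open>x\<^sup>\<gamma>\<close>, with
  \<open>\<gamma>\<close> split into its positive part (numerator) and negative part (denominator); it is zero unless
  the denominator is supported on \<open>F\<close>.\<close>

definition \<iota> :: "nat set \<Rightarrow> 'k \<Rightarrow> ('k mpoly set \<times> 'k mpoly) set" where
  "\<iota> F c = (if {i. \<gamma> i < 0} \<subseteq> F
     then fraction M (Mon F) (Q (Poly_Mapping.single (pos_exponent \<gamma>) c))
            (monomial (pos_exponent (\<lambda>i. - \<gamma> i)))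
     else \<zero>\<^bsub>loc_at V M F\<^esub>)"

lemma single_pos_mem [simp]: "Poly_Mapping.single (pos_exponent \<gamma>) c \<in> carrier R"
  using keys_pos by (rule single_mem_poly_ring)

lemma monomial_mem_Mon: "Poly_Mapping.keys e \<subseteq> F \<Longrightarrow> monomial e \<in> Mon F"
  by (auto simp: monomials_on_def)

lemma neg_mem_Mon: "{i. \<gamma> i < 0} \<subseteq> F \<Longrightarrow> monomial (pos_exponent (\<lambda>i. - \<gamma> i)) \<in> Mon F"
  by (rule monomial_mem_Mon) (simp add: keys_neg)

context
  fixes F assumes F: "F \<subseteq> V"
begin

interpretation module_localization R M "Mon F"
  by (rule module_localization_Mon[OF F])

lemma loc_at_eq: "loc_at V M F = L"
  by (simp add: loc_at_def)

lemma abelian_group_loc_at: "abelian_group (loc_at V M F)"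
  unfolding loc_at_eq by (rule abelian_group_localization)

lemma iota_closed: "\<iota> F c \<in> carrier (loc_at V M F)"
  using abelian_group_loc_at neg_mem_Mon[of F]
  by (auto simp: \<iota>_def loc_at_eq abelian_group_def abelian_monoid.zero_closed)

lemma iota_add: "\<iota> F c \<oplus>\<^bsub>loc_at V M F\<^esub> \<iota> F d = \<iota> F (c + d)"
proof (cases "{i. \<gamma> i < 0} \<subseteq> F")
  case True
  then show ?thesis
    using neg_mem_Mon[OF True]
    by (simp add: \<iota>_def loc_at_eq add_fraction_same_denominator Q_add single_add)
next
  case False
  interpret A: abelian_group "loc_at V M F" by (rule abelian_group_loc_at)
  show ?thesis using False by (simp add: \<iota>_def)
qed

lemma iota_0: "\<iota> F 0 = \<zero>\<^bsub>loc_at V M F\<^esub>"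
proof (cases "{i. \<gamma> i < 0} \<subseteq> F")
  case True
  then show ?thesis
    using neg_mem_Mon[OF True] fraction_zero by (simp add: \<iota>_def loc_at_eq zero_M)
qed (simp add: \<iota>_def)

lemma iota_minus: "\<ominus>\<^bsub>loc_at V M F\<^esub> \<iota> F c = \<iota> F (- c)"
  by (rule abelian_group.minus_equality[OF abelian_group_loc_at])
    (simp_all add: iota_add iota_0 iota_closed)

text \<open>A fraction is zero iff some monomial in the variables of \<open>F\<close> carries its
  numerator into \<open>K\<close>. As the numerator is a single term and \<open>K\<close> is spanned
  by monomials, for \<open>c \<noteq> 0\<close> this is a condition on exponents, the negation of
  the last clause of \<open>T\<close>.\<close>

lemma iota_eq_0_iff: "\<iota> F c = \<zero>\<^bsub>loc_at V M F\<^esub> \<longleftrightarrow> c = 0 \<or> F \<notin> T"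
proof (cases "{i. \<gamma> i < 0} \<subseteq> F")
  case True
  note neg = neg_mem_Mon[OF True]
  have one: "1 \<in> Mon F" using W_one by simp
  have "\<iota> F c = \<zero>\<^bsub>loc_at V M F\<^esub> \<longleftrightarrow>
      (\<exists>t\<in>Mon F. t \<odot>\<^bsub>M\<^esub> (\<one>\<^bsub>R\<^esub> \<odot>\<^bsub>M\<^esub> Q (Poly_Mapping.single (pos_exponent \<gamma>) c)) =
         t \<odot>\<^bsub>M\<^esub> (monomial (pos_exponent (\<lambda>i. - \<gamma> i)) \<odot>\<^bsub>M\<^esub> \<zero>\<^bsub>M\<^esub>))"
    using True neg one by (simp add: \<iota>_def loc_at_eq zero_localization fraction_eq_iff)
  also have "\<dots> \<longleftrightarrow> (\<exists>t\<in>Mon F. t * Poly_Mapping.single (pos_exponent \<gamma>) c \<in> K)"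
  proof (rule bex_cong[OF refl])
    fix t assume t: "t \<in> Mon F"
    then have tc: "t \<in> carrier R" by simp
    have 0: "t \<odot>\<^bsub>M\<^esub> (monomial (pos_exponent (\<lambda>i. - \<gamma> i)) \<odot>\<^bsub>M\<^esub> \<zero>\<^bsub>M\<^esub>) = Q 0"
      using M.smult_r_null[OF tc] M.smult_r_null[OF W_in_carrier[OF neg]] by (simp only: zero_M)
    have 1: "t \<odot>\<^bsub>M\<^esub> (\<one>\<^bsub>R\<^esub> \<odot>\<^bsub>M\<^esub> Q (Poly_Mapping.single (pos_exponent \<gamma>) c)) =
        Q (t * Poly_Mapping.single (pos_exponent \<gamma>) c)"
      using tc by (simp add: M.smult_one[simplified] smult_Q)
    have zc: "0 \<in> carrier R" using M.R.zero_closed by simp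
    show "(t \<odot>\<^bsub>M\<^esub> (\<one>\<^bsub>R\<^esub> \<odot>\<^bsub>M\<^esub> Q (Poly_Mapping.single (pos_exponent \<gamma>) c)) =
         t \<odot>\<^bsub>M\<^esub> (monomial (pos_exponent (\<lambda>i. - \<gamma> i)) \<odot>\<^bsub>M\<^esub> \<zero>\<^bsub>M\<^esub>)) \<longleftrightarrow>
        (t * Poly_Mapping.single (pos_exponent \<gamma>) c \<in> K)"
      unfolding 0 1 using Q_eq_iff[OF mult_mem_poly_ring[OF tc single_pos_mem] zc] by simp
  qed
  also have "\<dots> \<longleftrightarrow> (\<exists>h. Poly_Mapping.keys h \<subseteq> F \<and> Poly_Mapping.single (pos_exponent \<gamma> + h) c \<in> K)"
  proof -
    have "Poly_Mapping.single (pos_exponent \<gamma> + h) c = monomial h * Poly_Mapping.single (pos_exponent \<gamma>) c" for h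
      by (simp add: mult_single add.commute)
    then show ?thesis unfolding monomials_on_def by auto
  qed
  also have "\<dots> \<longleftrightarrow> c = 0 \<or> (\<exists>h. Poly_Mapping.keys h \<subseteq> F \<and> pos_exponent \<gamma> + h \<in> X)"
  proof -
    have "Poly_Mapping.single (pos_exponent \<gamma> + h) c \<in> K \<longleftrightarrow> c = 0 \<or> pos_exponent \<gamma> + h \<in> X"
      if "Poly_Mapping.keys h \<subseteq> F" for h
      using that F keys_pos by (auto simp: K_eq mon_ideal_def mem_poly_ring_iff keys_add_nat)
    moreover have "\<exists>h :: nat \<Rightarrow>\<^sub>0 nat. Poly_Mapping.keys h \<subseteq> F" by (rule exI[of _ 0]) simp
    ultimately show ?thesis by metis
  qed
  also have "\<dots> \<longleftrightarrow> c = 0 \<or> F \<notin> T"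
    using True F by (auto simp: T_def)
  finally show ?thesis .
qed (auto simp: \<iota>_def T_def)

lemma iota_eq_iff: "\<iota> F c = \<iota> F d \<longleftrightarrow> c = d \<or> F \<notin> T"
proof -
  interpret A: abelian_group "loc_at V M F" by (rule abelian_group_loc_at)
  have "\<iota> F c = \<iota> F (c - d) \<oplus>\<^bsub>loc_at V M F\<^esub> \<iota> F d" "\<iota> F (c - d) = \<iota> F c \<oplus>\<^bsub>loc_at V M F\<^esub> \<iota> F (- d)"
    "\<iota> F d \<oplus>\<^bsub>loc_at V M F\<^esub> \<iota> F (- d) = \<zero>\<^bsub>loc_at V M F\<^esub>"
    by (simp_all add: iota_add iota_0)
  then have "\<iota> F c = \<iota> F d \<longleftrightarrow> \<iota> F (c - d) = \<zero>\<^bsub>loc_at V M F\<^esub>"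
    using A.l_zero[OF iota_closed[of d]] by metis
  then show ?thesis by (simp add: iota_eq_0_iff)
qed

lemma zero_mem_loc_piece: "\<zero>\<^bsub>loc_at V M F\<^esub> \<in> loc_piece M G F \<gamma>"
proof -
  have "fraction M (Mon F) (Q 0) (monomial 0) \<in> loc_piece M G F \<gamma>"
    unfolding loc_piece_def quot_grading_def
    by (rule CollectI, rule exI[of _ "Q 0"], rule exI[of _ 0])
      (auto simp: mem_poly_ring_iff intro!: image_eqI[of _ _ 0])
  then show ?thesis by (simp add: loc_at_eq zero_localization zero_M)
qed

text \<open>All terms of a homogeneous numerator have the same exponent \<open>a\<close>, namely
  \<gamma> plus the exponent \<open>e\<close> of the denominator, so the numerator is a single term.
  Adding the negative part of \<gamma> to \<open>a\<close> gives \<open>e\<close> plus the positive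
  part, which identifies the fraction with the standard one.\<close>

lemma loc_piece_eq: "loc_piece M G F \<gamma> = range (\<iota> F)"
proof (intro equalityI subsetI)
  fix x assume "x \<in> loc_piece M G F \<gamma>"
  then obtain e f where x: "x = fraction M (Mon F) (Q f) (monomial e)"
    and e: "Poly_Mapping.keys e \<subseteq> F" and f: "f \<in> carrier R"
    and deg: "\<And>a i. a \<in> Poly_Mapping.keys f \<Longrightarrow> int (Poly_Mapping.lookup a i) = \<gamma> i + int (Poly_Mapping.lookup e i)"
    unfolding loc_piece_def quot_grading_def by blast
  note eM = monomial_mem_Mon[OF e]
  show "x \<in> range (\<iota> F)"
  proof (cases "f = 0")
    case True
    then have "x = \<iota> F 0"
      using fraction_zero[OF eM] by (simp add: x iota_0 loc_at_eq zero_M)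
    then show ?thesis by blast
  next
    case False
    then obtain a where a: "a \<in> Poly_Mapping.keys f" by (metis keys_eq_empty ex_in_conv)
    have "b = a" if "b \<in> Poly_Mapping.keys f" for b
      using deg[OF a] deg[OF that] by (intro poly_mapping_eqI) (metis of_nat_eq_iff)
    then have keys: "Poly_Mapping.keys f = {a}" using a by blast
    define c where "c = Poly_Mapping.lookup f a"
    have fc: "f = Poly_Mapping.single a c"
      using poly_mapping_sum_single[of f] by (simp add: keys c_def)
    have neg: "{i. \<gamma> i < 0} \<subseteq> F"
    proof
      fix i assume "i \<in> {i. \<gamma> i < 0}"
      then have "Poly_Mapping.lookup e i \<noteq> 0" using deg[OF a, of i] by auto
      then show "i \<in> F" using e by (auto simp: in_keys_iff)
    qed
    have sum: "pos_exponent (\<lambda>i. - \<gamma> i) + a = e + pos_exponent \<gamma>"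
    proof (rule poly_mapping_eqI)
      fix i
      show "Poly_Mapping.lookup (pos_exponent (\<lambda>i. - \<gamma> i) + a) i = Poly_Mapping.lookup (e + pos_exponent \<gamma>) i"
        using deg[OF a, of i] by (simp add: lookup_add lookup_pos lookup_neg)
    qed
    note nM = neg_mem_Mon[OF neg]
    have "x = \<iota> F c"
      unfolding x \<iota>_def if_P[OF neg]
    proof (rule fraction_eqI)
      show "monomial (pos_exponent (\<lambda>i. - \<gamma> i)) \<odot>\<^bsub>M\<^esub> Q f =
          monomial e \<odot>\<^bsub>M\<^esub> Q (Poly_Mapping.single (pos_exponent \<gamma>) c)"
        using f eM nM by (simp add: smult_Q fc mult_single sum)
    qed (use f eM nM in simp_all)
    then show ?thesis by blast
  qed
next
  fix x assume "x \<in> range (\<iota> F)"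
  then obtain c where x: "x = \<iota> F c" by blast
  show "x \<in> loc_piece M G F \<gamma>"
  proof (cases "{i. \<gamma> i < 0} \<subseteq> F")
    case True
    show ?thesis
      unfolding x \<iota>_def if_P[OF True] loc_piece_def quot_grading_def
      by (rule CollectI, intro exI conjI, rule refl)
        (auto simp: keys_neg True lookup_pos lookup_neg intro!: imageI)
  next
    case False
    then show ?thesis using zero_mem_loc_piece by (simp add: x \<iota>_def)
  qed
qed

lemma finsum_iota:
  assumes "finite A"
  shows "finsum (loc_at V M F) (\<lambda>i. \<iota> F (g i)) A = \<iota> F (\<Sum>i\<in>A. g i)"
proof -
  interpret A: abelian_group "loc_at V M F" by (rule abelian_group_loc_at)
  from assms show ?thesis
    by (induction A rule: finite_induct) (simp_all add: iota_0 iota_closed iota_add A.finsum_insert)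
qed

text \<open>The condition on \<open>c\<close> is essential: if the negative support is not contained
  in \<open>F'\<close>, then \<open>\<iota> F' c\<close> is zero for every \<open>c\<close>, whereas
  \<open>\<iota> F c\<close> may be nonzero.\<close>

lemma frac_rel_Image_iota:
  assumes "F' \<subseteq> F" "c = 0 \<or> F' \<in> T"
  shows "frac_rel M (Mon F) `` \<iota> F' c = \<iota> F c"
proof -
  have F': "F' \<subseteq> V" using assms(1) F by blast
  interpret F': module_localization R M "Mon F'" by (rule module_localization_Mon[OF F'])
  have sub: "Mon F' \<subseteq> Mon F" using assms(1) by (auto simp: monomials_on_def)
  show ?thesis
  proof (cases "{i. \<gamma> i < 0} \<subseteq> F'")
    case True
    then have "{i. \<gamma> i < 0} \<subseteq> F" using assms(1) by blast
    then show ?thesis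
      using frac_rel_Image_fraction[OF sub F'.W_one _ neg_mem_Mon[OF True]] True by (simp add: \<iota>_def)
  next
    case False
    then have c: "c = 0" using assms(2) by (auto simp: T_def)
    have "\<iota> F' c = fraction M (Mon F') \<zero>\<^bsub>M\<^esub> \<one>\<^bsub>R\<^esub>"
      using False F'.zero_localization by (simp add: \<iota>_def loc_at_def)
    then have "frac_rel M (Mon F) `` \<iota> F' c = fraction M (Mon F) \<zero>\<^bsub>M\<^esub> \<one>\<^bsub>R\<^esub>"
      using frac_rel_Image_fraction[OF sub F'.W_one M.M.zero_closed F'.W_one] by simp
    then show ?thesis using c by (simp add: iota_0 loc_at_eq zero_localization)
  qed
qed

end

abbreviation "k_type \<equiv> TYPE('k)"

text \<open>The passage from combinatorial cochains to Cech cochains; by \<open>Phi_eq_iff\<close>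
  it forgets exactly the values off the faces of \<open>T\<close> with \<open>p\<close>
  elements.\<close>

definition \<Phi> :: "nat \<Rightarrow> (nat set \<Rightarrow> 'k) \<Rightarrow> nat set \<Rightarrow> ('k mpoly set \<times> 'k mpoly) set" where
  "\<Phi> p c = (\<lambda>F\<in>faces V p. \<iota> F (c F))"

lemma Phi_eq_iff: "\<Phi> p c = \<Phi> p d \<longleftrightarrow> (\<forall>F\<in>T. card F = p \<longrightarrow> c F = d F)"
proof -
  have "\<Phi> p c = \<Phi> p d \<longleftrightarrow> (\<forall>F\<in>faces V p. \<iota> F (c F) = \<iota> F (d F))"
    unfolding \<Phi>_def restrict_def fun_eq_iff by auto
  also have "\<dots> \<longleftrightarrow> (\<forall>F\<in>faces V p. c F = d F \<or> F \<notin> T)"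
    using iota_eq_iff by (auto simp: faces_def)
  also have "\<dots> \<longleftrightarrow> (\<forall>F\<in>T. card F = p \<longrightarrow> c F = d F)"
    by (auto simp: faces_def T_def)
  finally show ?thesis .
qed

lemma carrier_cech_group: "carrier (cech_group V M G p \<gamma>) = \<Phi> p ` cochains k_type T p"
proof (intro equalityI subsetI)
  fix z assume z: "z \<in> carrier (cech_group V M G p \<gamma>)"
  then have pieces: "z F \<in> range (\<iota> F)" if "F \<in> faces V p" for F
    using that loc_piece_eq[of F] by (auto simp: cech_group_def faces_def)
  have "\<forall>F\<in>faces V p. \<exists>c. z F = \<iota> F c"
    using pieces by blast
  then obtain f where f: "\<forall>F\<in>faces V p. z F = \<iota> F (f F)"
    using bchoice by metis
  \<comment> \<open>Off \<open>T\<close> the map \<open>\<iota> F\<close> is constantly zero, so the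
    coefficient can be reset to 0 there.\<close>
  define c where "c F = (if F \<in> T \<and> card F = p then f F else 0)" for F
  have "z = \<Phi> p c"
  proof (rule ext)
    fix F
    show "z F = \<Phi> p c F"
    proof (cases "F \<in> faces V p")
      case True
      then have "F \<subseteq> V" "card F = p" by (auto simp: faces_def)
      then show ?thesis using True f iota_eq_iff[of F "f F" "c F"] by (simp add: \<Phi>_def c_def)
    next
      case False
      then show ?thesis using z by (auto simp: \<Phi>_def cech_group_def PiE_def extensional_def)
    qed
  qed
  moreover have "c \<in> cochains k_type T p"
    by (auto simp: cochains_def c_def split: if_splits)
  ultimately show "z \<in> \<Phi> p ` cochains k_type T p" by blast
next
  fix z assume "z \<in> \<Phi> p ` cochains k_type T p"
  then obtain c where z: "z = \<Phi> p c" by blast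
  have "\<iota> F (c F) \<in> loc_piece M G F \<gamma>" if "F \<in> faces V p" for F
    using that loc_piece_eq[of F] by (simp add: faces_def)
  then show "z \<in> carrier (cech_group V M G p \<gamma>)"
    by (simp add: z \<Phi>_def cech_group_def)
qed

lemma one_cech_group: "\<one>\<^bsub>cech_group V M G p \<gamma>\<^esub> = \<Phi> p (\<lambda>_. 0)"
  using iota_0 by (auto simp: cech_group_def \<Phi>_def faces_def intro!: restrict_ext)

lemma mult_cech_group: "\<Phi> p c \<otimes>\<^bsub>cech_group V M G p \<gamma>\<^esub> \<Phi> p d = \<Phi> p (\<lambda>F. c F + d F)"
  using iota_add by (auto simp: cech_group_def \<Phi>_def faces_def intro!: restrict_ext)

lemma cech_diff_Phi:
  assumes c: "c \<in> cochains k_type T p"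
  shows "cech_diff V M p (\<Phi> p c) = \<Phi> (Suc p) (cobd c)"
  unfolding cech_diff_def \<Phi>_def[of "Suc p"]
proof (rule restrict_ext)
  fix F assume "F \<in> faces V (Suc p)"
  then have F: "F \<subseteq> V" "card F = Suc p" by (auto simp: faces_def)
  then have fin: "finite F" using finite_V finite_subset by blast
  interpret A: abelian_group "loc_at V M F" by (rule abelian_group_loc_at[OF F(1)])
  have y: "frac_rel M (monomials_on F) `` \<Phi> p c (F - {i}) = \<iota> F (c (F - {i}))" if "i \<in> F" for i
  proof -
    have "F - {i} \<in> faces V p" using F that fin by (auto simp: faces_def)
    moreover have "c (F - {i}) = 0 \<or> F - {i} \<in> T"
      using c by (auto simp: cochains_def)
    ultimately show ?thesis
      using frac_rel_Image_iota[OF F(1), of "F - {i}" "c (F - {i})"] by (auto simp: \<Phi>_def)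
  qed
  define g where "g i = (if even (card {j \<in> F. j < i}) then c (F - {i}) else - c (F - {i}))" for i
  have "finsum (loc_at V M F)
          (\<lambda>i. let y = frac_rel M (monomials_on F) `` \<Phi> p c (F - {i})
               in if even (card {j \<in> F. j < i}) then y else \<ominus>\<^bsub>loc_at V M F\<^esub> y) F =
        finsum (loc_at V M F) (\<lambda>i. \<iota> F (g i)) F"
    by (rule A.finsum_cong')
      (auto simp: y g_def iota_minus[OF F(1)] iota_closed[OF F(1)] Let_def)
  also have "\<dots> = \<iota> F (cobd c F)"
    using finsum_iota[OF F(1) fin] by (simp add: cobd_def g_def)
  finally show "finsum (loc_at V M F)
          (\<lambda>i. let y = frac_rel M (monomials_on F) `` \<Phi> p c (F - {i})
               in if even (card {j \<in> F. j < i}) then y else \<ominus>\<^bsub>loc_at V M F\<^esub> y) F = \<iota> F (cobd c F)" .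
qed

lemma cech_boundaries_eq: "cech_boundaries V M G p \<gamma> = \<Phi> p ` coboundaries k_type T p"
proof (cases p)
  case 0
  then show ?thesis by (simp add: cech_boundaries_def coboundaries_def one_cech_group)
next
  case (Suc q)
  have "cech_diff V M q ` \<Phi> q ` cochains k_type T q = \<Phi> (Suc q) ` cobd ` cochains k_type T q"
    unfolding image_image by (rule image_cong) (simp_all add: cech_diff_Phi)
  then show ?thesis by (simp add: Suc cech_boundaries_def coboundaries_def carrier_cech_group)
qed

lemma kernel_cech_diff:
  "kernel (cech_group V M G p \<gamma>) (cech_group V M G (Suc p) \<gamma>) (cech_diff V M p) =
    \<Phi> p ` {c \<in> cochains k_type T p. \<forall>F\<in>T. card F = Suc p \<longrightarrow> cobd c F = 0}"
proof -
  have "cech_diff V M p (\<Phi> p c) = \<one>\<^bsub>cech_group V M G (Suc p) \<gamma>\<^esub> \<longleftrightarrow>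
      (\<forall>F\<in>T. card F = Suc p \<longrightarrow> cobd c F = 0)" if "c \<in> cochains k_type T p" for c
    using that by (simp add: cech_diff_Phi one_cech_group Phi_eq_iff)
  then show ?thesis unfolding kernel_def carrier_cech_group by auto
qed

text \<open>The identity of a factor group is the set that is factored out. So the quotient is
  trivial iff the coset of each cycle is the set of boundaries, that is, iff each cycle agrees with
  a coboundary on \<open>T\<close>.\<close>

lemma local_cohomology_nontrivial_iff:
  "carrier (local_cohomology V M G p \<gamma>) \<noteq> {\<one>\<^bsub>local_cohomology V M G p \<gamma>\<^esub>} \<longleftrightarrow>
    nontrivial_cohomology k_type T p"
proof -
  define Z where "Z = {c \<in> cochains k_type T p. \<forall>F\<in>T. card F = Suc p \<longrightarrow> cobd c F = 0}"
  define B where "B = \<Phi> p ` coboundaries k_type T p"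
  define C where "C = cech_group V M G p \<gamma>\<lparr>carrier := \<Phi> p ` Z\<rparr>"
  have lc: "local_cohomology V M G p \<gamma> = C Mod B"
    unfolding local_cohomology_def kernel_cech_diff cech_boundaries_eq Z_def B_def C_def by simp
  have mult: "\<Phi> p c \<otimes>\<^bsub>C\<^esub> \<Phi> p d = \<Phi> p (\<lambda>F. c F + d F)" for c d
    using mult_cech_group by (simp add: C_def)
  have coset: "B #>\<^bsub>C\<^esub> \<Phi> p c = (\<lambda>b. \<Phi> p (\<lambda>F. b F + c F)) ` coboundaries k_type T p" for c
    by (auto simp: r_coset_def B_def mult)
  have coset_eq: "B #>\<^bsub>C\<^esub> \<Phi> p c = B \<longleftrightarrow> \<Phi> p c \<in> B" for c
  proof
    assume "B #>\<^bsub>C\<^esub> \<Phi> p c = B"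
    moreover have "\<Phi> p c \<in> B #>\<^bsub>C\<^esub> \<Phi> p c"
      unfolding coset using zero_mem_coboundaries[of k_type T p]
      by (intro image_eqI[of _ _ "\<lambda>_. 0"]) simp_all
    ultimately show "\<Phi> p c \<in> B" by simp
  next
    assume "\<Phi> p c \<in> B"
    then obtain d where d: "d \<in> coboundaries k_type T p" "\<Phi> p c = \<Phi> p d"
      by (auto simp: B_def)
    show "B #>\<^bsub>C\<^esub> \<Phi> p c = B"
      unfolding d(2) coset unfolding B_def
    proof (intro equalityI subsetI)
      fix z assume "z \<in> (\<lambda>b. \<Phi> p (\<lambda>F. b F + d F)) ` coboundaries k_type T p"
      then show "z \<in> \<Phi> p ` coboundaries k_type T p"
        using coboundaries_add[OF _ d(1)] by blast
    next
      fix z assume "z \<in> \<Phi> p ` coboundaries k_type T p"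
      then obtain b where "b \<in> coboundaries k_type T p" "z = \<Phi> p b" by blast
      then show "z \<in> (\<lambda>b. \<Phi> p (\<lambda>F. b F + d F)) ` coboundaries k_type T p"
        using coboundaries_minus[OF _ d(1), of b]
        by (intro image_eqI[of _ _ "\<lambda>F. b F - d F"]) simp_all
    qed
  qed
  have "carrier (C Mod B) = (\<lambda>c. B #>\<^bsub>C\<^esub> \<Phi> p c) ` Z"
    by (auto simp: carrier_FactGroup C_def)
  moreover have "(\<lambda>_. 0) \<in> Z"
    by (auto simp: Z_def cochains_def)
  ultimately have "carrier (C Mod B) = {\<one>\<^bsub>C Mod B\<^esub>} \<longleftrightarrow> (\<forall>c\<in>Z. B #>\<^bsub>C\<^esub> \<Phi> p c = B)"
    by auto
  also have "\<dots> \<longleftrightarrow> (\<forall>c\<in>Z. \<exists>b\<in>coboundaries k_type T p. \<forall>F\<in>T. card F = p \<longrightarrow> c F = b F)"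
    unfolding coset_eq unfolding B_def image_iff Phi_eq_iff ..
  finally show ?thesis
    unfolding lc nontrivial_cohomology_def Z_def by blast
qed

end

section \<open>Regularity through degree complexes\<close>

text \<open>The threshold \<open>s\<close> is an integer because the degree spent on the variables
  of another block is subtracted from it, and the result may drop below 1.\<close>

definition degree_complex :: "nat set \<Rightarrow> nat set set \<Rightarrow> int \<Rightarrow> (nat \<Rightarrow> int) \<Rightarrow> nat set set" where
  "degree_complex V D s \<gamma> =
    {F. F \<subseteq> V \<and> {i. \<gamma> i < 0} \<subseteq> F \<and> (\<exists>F'\<in>D. F \<subseteq> F' \<and> (\<Sum>i\<in>V - F'. \<gamma> i) < s)}"

definition cohomology_degrees :: "'k::ab_group_add itself \<Rightarrow> nat set \<Rightarrow> nat set set \<Rightarrow> nat \<Rightarrow> int set" where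
  "cohomology_degrees k V D s = {int p + (\<Sum>i\<in>V. \<gamma> i) | p \<gamma>.
     (\<forall>i. i \<notin> V \<longrightarrow> \<gamma> i = 0) \<and> nontrivial_cohomology k (degree_complex V D (int s) \<gamma>) p}"

text \<open>Off a face \<open>F'\<close> that contains \<open>F\<close>, the degree has no negative
  entries and \<open>h\<close> vanishes. There the exponent \<open>pos_exponent \<gamma> + h\<close>
  agrees with \<gamma>, whatever \<open>h\<close> is.\<close>

lemma T_symbolic_power:
  assumes loc: "monomial_quotient V X \<gamma> K" and X: "X = {e. \<forall>F\<in>D. s \<le> (\<Sum>i\<in>V - F. Poly_Mapping.lookup e i)}"
  shows "monomial_quotient.T V X \<gamma> = degree_complex V D (int s) \<gamma>"
proof -
  interpret monomial_quotient V X \<gamma> K by fact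
  have sum_eq: "int (\<Sum>i\<in>V - F'. Poly_Mapping.lookup (pos_exponent \<gamma> + h) i) = (\<Sum>i\<in>V - F'. \<gamma> i)"
    if "F \<subseteq> F'" "{i. \<gamma> i < 0} \<subseteq> F" "Poly_Mapping.keys h \<subseteq> F" for F F' h
    unfolding of_nat_sum
  proof (rule sum.cong[OF refl])
    fix i assume "i \<in> V - F'"
    then have "i \<notin> {i. \<gamma> i < 0}" "i \<notin> Poly_Mapping.keys h" using that by auto
    then show "int (Poly_Mapping.lookup (pos_exponent \<gamma> + h) i) = \<gamma> i"
      by (simp add: lookup_add lookup_pos in_keys_iff)
  qed
  have "(\<forall>h. Poly_Mapping.keys h \<subseteq> F \<longrightarrow> pos_exponent \<gamma> + h \<notin> X) \<longleftrightarrow>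
      (\<exists>F'\<in>D. F \<subseteq> F' \<and> (\<Sum>i\<in>V - F'. \<gamma> i) < int s)"
    if F: "F \<subseteq> V" "{i. \<gamma> i < 0} \<subseteq> F" for F
  proof
    assume notin: "\<forall>h. Poly_Mapping.keys h \<subseteq> F \<longrightarrow> pos_exponent \<gamma> + h \<notin> X"
    have "finite F" using F(1) finite_V finite_subset by blast
    \<comment> \<open>The exponent is chosen so large on \<open>F\<close> that a face missing a
      vertex of \<open>F\<close> has a sum above \<open>s\<close>; the face whose condition is
      violated must therefore contain \<open>F\<close>.\<close>
    from ex_indicator_exponent[OF this, of "Suc s"] obtain h :: "nat \<Rightarrow>\<^sub>0 nat"
      where h: "Poly_Mapping.keys h = F" "\<forall>i\<in>F. Poly_Mapping.lookup h i = Suc s" by auto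
    then have "pos_exponent \<gamma> + h \<notin> X" using notin by simp
    then obtain F' where F': "F' \<in> D" "(\<Sum>i\<in>V - F'. Poly_Mapping.lookup (pos_exponent \<gamma> + h) i) < s"
      unfolding X by (auto simp: not_le)
    have "F \<subseteq> F'"
    proof (rule ccontr)
      assume "\<not> F \<subseteq> F'"
      then obtain i where i: "i \<in> F" "i \<in> V - F'" using F by blast
      then have "Poly_Mapping.lookup (pos_exponent \<gamma> + h) i \<le>
          (\<Sum>i\<in>V - F'. Poly_Mapping.lookup (pos_exponent \<gamma> + h) i)"
        using finite_V by (intro member_le_sum) auto
      then show False using F'(2) i h(2) by (simp add: lookup_add)
    qed
    moreover from this have "(\<Sum>i\<in>V - F'. \<gamma> i) < int s"
      using F'(2) sum_eq[of F F' h] F h(1) by (simp del: of_nat_sum flip: of_nat_less_iff)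
    ultimately show "\<exists>F'\<in>D. F \<subseteq> F' \<and> (\<Sum>i\<in>V - F'. \<gamma> i) < int s"
      using F'(1) by blast
  next
    assume "\<exists>F'\<in>D. F \<subseteq> F' \<and> (\<Sum>i\<in>V - F'. \<gamma> i) < int s"
    then obtain F' where F': "F' \<in> D" "F \<subseteq> F'" "(\<Sum>i\<in>V - F'. \<gamma> i) < int s" by blast
    show "\<forall>h. Poly_Mapping.keys h \<subseteq> F \<longrightarrow> pos_exponent \<gamma> + h \<notin> X"
    proof (intro allI impI)
      fix h :: "nat \<Rightarrow>\<^sub>0 nat" assume "Poly_Mapping.keys h \<subseteq> F"
      then have "int (\<Sum>i\<in>V - F'. Poly_Mapping.lookup (pos_exponent \<gamma> + h) i) < int s"
        using sum_eq[of F F' h] F F' by (simp del: of_nat_sum)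
      then have "\<not> s \<le> (\<Sum>i\<in>V - F'. Poly_Mapping.lookup (pos_exponent \<gamma> + h) i)"
        by linarith
      then show "pos_exponent \<gamma> + h \<notin> X"
        using F'(1) unfolding X by blast
    qed
  qed
  then show ?thesis unfolding T_def degree_complex_def by blast
qed

lemma reg_quot_symbolic_power:
  assumes D: "simplicial V D" and V: "finite V"
  shows "reg_quot V (symbolic_power (poly_ring V) (sr_ideal V D :: 'k::idom mpoly set) s) =
    Sup ((\<lambda>d. ereal (of_int d)) ` cohomology_degrees TYPE('k) V D s)"
proof -
  define X where "X = {e. \<forall>F\<in>D. s \<le> (\<Sum>i\<in>V - F. Poly_Mapping.lookup e i)}"
  define K where "K = (mon_ideal V X :: 'k mpoly set)"
  have K: "symbolic_power (poly_ring V) (sr_ideal V D :: 'k mpoly set) s = K"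
    unfolding K_def X_def by (rule symbolic_power_sr_ideal[OF D V])
  have "carrier (local_cohomology V (quot_module (poly_ring V) K) (quot_grading V K) p \<gamma>) \<noteq>
      {\<one>\<^bsub>local_cohomology V (quot_module (poly_ring V) K) (quot_grading V K) p \<gamma>\<^esub>} \<longleftrightarrow>
      nontrivial_cohomology TYPE('k) (degree_complex V D (int s) \<gamma>) p"
    if \<gamma>: "\<forall>i. i \<notin> V \<longrightarrow> \<gamma> i = 0" for p \<gamma>
  proof -
    have "e + h \<in> X" if "e \<in> X" for e h
      unfolding X_def
    proof (intro CollectI ballI)
      fix F assume "F \<in> D"
      then have "s \<le> (\<Sum>i\<in>V - F. Poly_Mapping.lookup e i)" using that by (simp add: X_def)
      then show "s \<le> (\<Sum>i\<in>V - F. Poly_Mapping.lookup (e + h) i)"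
        by (simp add: lookup_add sum.distrib)
    qed
    then have loc: "monomial_quotient V X \<gamma> K"
      using V \<gamma> by unfold_locales (auto simp: K_def)
    show ?thesis
      using monomial_quotient.local_cohomology_nontrivial_iff[OF loc, of p]
        T_symbolic_power[OF loc X_def] by simp
  qed
  then have eq: "((\<forall>i. i \<notin> V \<longrightarrow> \<gamma> i = 0) \<and>
      carrier (local_cohomology V (quot_module (poly_ring V) K) (quot_grading V K) p \<gamma>) \<noteq>
      {\<one>\<^bsub>local_cohomology V (quot_module (poly_ring V) K) (quot_grading V K) p \<gamma>\<^esub>}) \<longleftrightarrow>
      ((\<forall>i. i \<notin> V \<longrightarrow> \<gamma> i = 0) \<and>
      nontrivial_cohomology TYPE('k) (degree_complex V D (int s) \<gamma>) p)" for p \<gamma>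
    by blast
  have image: "{f (g p \<gamma>) | p \<gamma>. P p \<gamma>} = f ` {g p \<gamma> | p \<gamma>. P p \<gamma>}"
    for f :: "int \<Rightarrow> ereal" and g :: "nat \<Rightarrow> (nat \<Rightarrow> int) \<Rightarrow> int" and P
    by blast
  show ?thesis
    unfolding K reg_quot_def regularity_def cohomology_degrees_def eq
    by (rule arg_cong[where f = Sup]) (rule image)
qed

text \<open>Entries off a face containing the negative support are nonnegative, so their sum is
  never below a threshold \<open>s \<le> 0\<close>. Read backwards, a nonempty complex has a
  positive threshold; this bounds the degree in the other block.\<close>

lemma degree_complex_empty:
  assumes "s \<le> 0"
  shows "degree_complex V D s \<gamma> = {}"
proof -
  have False if "F \<subseteq> F'" "{i. \<gamma> i < 0} \<subseteq> F" "(\<Sum>i\<in>V - F'. \<gamma> i) < s" for F F'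
  proof -
    have "0 \<le> (\<Sum>i\<in>V - F'. \<gamma> i)"
      using that(1,2) by (intro sum_nonneg) force
    then show False using that(3) assms by simp
  qed
  then show ?thesis unfolding degree_complex_def by blast
qed

section \<open>Cohomology of a union of complexes on disjoint vertex sets\<close>

lemma nontrivial_cohomology_imp_nonempty: "nontrivial_cohomology k T p \<Longrightarrow> T \<noteq> {}"
  unfolding nontrivial_cohomology_def using zero_mem_coboundaries by fastforce

lemma nontrivial_cohomology_Suc:
  "nontrivial_cohomology k T (Suc q) \<longleftrightarrow>
    (\<exists>c\<in>cochains k T (Suc q). (\<forall>F\<in>T. card F = Suc (Suc q) \<longrightarrow> cobd c F = 0) \<and>
      (\<forall>b\<in>cochains k T q. \<exists>F\<in>T. card F = Suc q \<and> c F \<noteq> cobd b F))"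
  unfolding nontrivial_cohomology_def coboundaries_def by auto

definition restr :: "nat set set \<Rightarrow> (nat set \<Rightarrow> 'k::zero) \<Rightarrow> nat set \<Rightarrow> 'k" where
  "restr T c F = (if F \<in> T then c F else 0)"

lemma restr_mem_cochains: "c \<in> cochains k T' p \<Longrightarrow> restr T c \<in> cochains k T p"
  by (auto simp: cochains_def restr_def split: if_splits)

lemma cobd_cong:
  assumes "\<And>i. i \<in> F \<Longrightarrow> b (F - {i}) = c (F - {i})"
  shows "cobd b F = cobd c F"
  unfolding cobd_def by (rule sum.cong[OF refl]) (simp add: assms)

lemma cobd_eq_0:
  assumes "\<And>i. i \<in> F \<Longrightarrow> c (F - {i}) = 0"
  shows "cobd c F = 0"
  using cobd_cong[of F c "\<lambda>_. 0"] assms by simp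

lemma cobd_restr:
  assumes "simplicial M T" "F \<in> T"
  shows "cobd (restr T c) F = cobd c F"
proof (rule cobd_cong)
  fix i
  have "Pow F \<subseteq> T" using assms by (simp add: simplicial_def)
  then show "restr T c (F - {i}) = c (F - {i})" by (auto simp: restr_def)
qed

context
  fixes M N T1 T2
  assumes T1: "simplicial M T1" and T2: "simplicial N T2" and disj: "M \<inter> N = {}"
begin

text \<open>Only the empty face is common to both complexes, and removing one of at least two
  vertices leaves a nonempty set.\<close>

lemma not_mem_other:
  assumes "F \<in> T2" "Suc 0 < card F"
  shows "F - {i} \<notin> T1"
proof
  assume "F - {i} \<in> T1"
  then have "F - {i} \<subseteq> M" "F \<subseteq> N" using T1 T2 assms(1) by (auto simp: simplicial_def)
  then have "F \<subseteq> {i}" using disj by blast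
  then have "card F \<le> card {i}" by (intro card_mono) auto
  then show False using assms(2) by simp
qed

lemma cobd_other:
  assumes "c \<in> cochains k T1 p" "F \<in> T2" "Suc 0 < card F"
  shows "cobd c F = 0"
  using assms(1) not_mem_other[OF assms(2,3)] by (intro cobd_eq_0) (auto simp: cochains_def)

text \<open>Extended by zero, a cycle stays a cycle by \<open>cobd_other\<close>; a primitive of it
  on the union would restrict to a primitive on \<open>T1\<close>.\<close>

lemma nontrivial_cohomology_UnI1:
  assumes "nontrivial_cohomology k T1 (Suc (Suc q))"
  shows "nontrivial_cohomology k (T1 \<union> T2) (Suc (Suc q))"
proof -
  obtain c where c: "c \<in> cochains k T1 (Suc (Suc q))"
    and cyc: "\<forall>F\<in>T1. card F = Suc (Suc (Suc q)) \<longrightarrow> cobd c F = 0"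
    and nb: "\<forall>b\<in>cochains k T1 (Suc q). \<exists>F\<in>T1. card F = Suc (Suc q) \<and> c F \<noteq> cobd b F"
    using assms unfolding nontrivial_cohomology_Suc[of k T1] by blast
  show ?thesis
    unfolding nontrivial_cohomology_Suc
  proof (intro bexI[of _ c] conjI ballI impI)
    show "c \<in> cochains k (T1 \<union> T2) (Suc (Suc q))"
      using c by (auto simp: cochains_def)
    fix F assume "F \<in> T1 \<union> T2" "card F = Suc (Suc (Suc q))"
    then show "cobd c F = 0" using cyc cobd_other[OF c, of F] by auto
  next
    fix b assume "b \<in> cochains k (T1 \<union> T2) (Suc q)"
    then have "restr T1 b \<in> cochains k T1 (Suc q)" by (rule restr_mem_cochains)
    with nb obtain F where F: "F \<in> T1" "card F = Suc (Suc q)" "c F \<noteq> cobd (restr T1 b) F" by blast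
    then show "\<exists>F\<in>T1 \<union> T2. card F = Suc (Suc q) \<and> c F \<noteq> cobd b F"
      using cobd_restr[OF T1 F(1), of b] by auto
  qed
qed

end

text \<open>The three cardinalities involved are at least 1, so the shared empty face does not enter
  and this stretch of the cochain complex is a direct sum.\<close>

lemma nontrivial_cohomology_Un_iff:
  assumes T1: "simplicial M T1" and T2: "simplicial N T2" and disj: "M \<inter> N = {}"
  shows "nontrivial_cohomology k (T1 \<union> T2) (Suc (Suc q)) \<longleftrightarrow>
    nontrivial_cohomology k T1 (Suc (Suc q)) \<or> nontrivial_cohomology k T2 (Suc (Suc q))"
proof
  have disj': "N \<inter> M = {}" using disj by blast
  assume "nontrivial_cohomology k (T1 \<union> T2) (Suc (Suc q))"
  then obtain c where c: "c \<in> cochains k (T1 \<union> T2) (Suc (Suc q))"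
    and cyc: "\<forall>F\<in>T1 \<union> T2. card F = Suc (Suc (Suc q)) \<longrightarrow> cobd c F = 0"
    and nb: "\<forall>b\<in>cochains k (T1 \<union> T2) (Suc q). \<exists>F\<in>T1 \<union> T2. card F = Suc (Suc q) \<and> c F \<noteq> cobd b F"
    unfolding nontrivial_cohomology_Suc[of k "T1 \<union> T2"] by blast
  show "nontrivial_cohomology k T1 (Suc (Suc q)) \<or> nontrivial_cohomology k T2 (Suc (Suc q))"
  proof (rule ccontr)
    assume none: "\<not> ?thesis"
    have *: "\<exists>b\<in>cochains k T (Suc q). \<forall>F\<in>T. card F = Suc (Suc q) \<longrightarrow> c F = cobd b F"
      if T: "simplicial U T" "T \<subseteq> T1 \<union> T2" "\<not> nontrivial_cohomology k T (Suc (Suc q))" for U T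
    proof -
      have "restr T c \<in> cochains k T (Suc (Suc q))" by (rule restr_mem_cochains[OF c])
      moreover have "\<forall>F\<in>T. card F = Suc (Suc (Suc q)) \<longrightarrow> cobd (restr T c) F = 0"
        using cyc T(2) cobd_restr[OF T(1), of _ c] by auto
      ultimately obtain b where "b \<in> cochains k T (Suc q)"
        "\<forall>F\<in>T. card F = Suc (Suc q) \<longrightarrow> restr T c F = cobd b F"
        using T(3) unfolding nontrivial_cohomology_Suc by blast
      then show ?thesis by (auto simp: restr_def)
    qed
    obtain b1 where b1: "b1 \<in> cochains k T1 (Suc q)"
      "\<forall>F\<in>T1. card F = Suc (Suc q) \<longrightarrow> c F = cobd b1 F"
      using *[OF T1] none by blast
    obtain b2 where b2: "b2 \<in> cochains k T2 (Suc q)"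
      "\<forall>F\<in>T2. card F = Suc (Suc q) \<longrightarrow> c F = cobd b2 F"
      using *[OF T2] none by blast
    \<comment> \<open>The two primitives do not interfere: the coboundary of each vanishes on the
      faces of the other complex.\<close>
    define b where "b F = b1 F + b2 F" for F
    have b_eq: "b = (\<lambda>F. b1 F + b2 F)" by (simp add: b_def fun_eq_iff)
    have "F \<in> T1 \<union> T2 \<and> card F = Suc q" if "b F \<noteq> 0" for F
    proof -
      have "b1 F \<noteq> 0 \<or> b2 F \<noteq> 0" using that by (auto simp: b_def)
      then show ?thesis using b1(1) b2(1) by (auto simp: cochains_def)
    qed
    then have "b \<in> cochains k (T1 \<union> T2) (Suc q)" by (simp add: cochains_def)
    then obtain F where F: "F \<in> T1 \<union> T2" "card F = Suc (Suc q)" "c F \<noteq> cobd b F" using nb by blast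
    have "cobd b F = cobd b1 F + cobd b2 F" by (simp add: b_eq cobd_add)
    moreover have "cobd b2 F = 0" if "F \<in> T1"
      by (rule cobd_other[OF T2 T1 disj' b2(1) that]) (simp add: F)
    moreover have "cobd b1 F = 0" if "F \<in> T2"
      by (rule cobd_other[OF T1 T2 disj b1(1) that]) (simp add: F)
    ultimately show False using F b1(2) b2(2) by auto
  qed
next
  have disj': "N \<inter> M = {}" using disj by blast
  assume "nontrivial_cohomology k T1 (Suc (Suc q)) \<or> nontrivial_cohomology k T2 (Suc (Suc q))"
  then show "nontrivial_cohomology k (T1 \<union> T2) (Suc (Suc q))"
    using nontrivial_cohomology_UnI1[OF T1 T2 disj, of k q]
      nontrivial_cohomology_UnI1[OF T2 T1 disj', of k q] by (auto simp: Un_commute)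
qed

section \<open>The lower bound for nonprime ideals\<close>

text \<open>Removing an element of \<open>G\<close> leaves a set that does not contain
  \<open>G\<close>, so only the term that removes \<open>x\<close> survives.\<close>

lemma cobd_insert:
  assumes "finite G" "x \<notin> G" "\<And>F. b F \<noteq> 0 \<Longrightarrow> G \<subseteq> F"
  shows "cobd b (insert x G) = (if even (card {j \<in> G. j < x}) then b G else - b G)"
proof -
  let ?f = "\<lambda>i. if even (card {j \<in> insert x G. j < i}) then b (insert x G - {i}) else - b (insert x G - {i})"
  have "b (insert x G - {i}) = 0" if "i \<in> G" for i
    using assms(3)[of "insert x G - {i}"] that by blast
  then have "sum ?f G = 0"
    by (intro sum.neutral) auto
  moreover have "{j \<in> insert x G. j < x} = {j \<in> G. j < x}" "insert x G - {x} = G"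
    using assms(2) by auto
  ultimately show ?thesis
    using assms(1,2) by (simp add: cobd_def)
qed

definition facet :: "nat set set \<Rightarrow> nat set \<Rightarrow> bool" where
  "facet D F \<longleftrightarrow> F \<in> D \<and> (\<forall>H\<in>D. F \<subseteq> H \<longrightarrow> H = F)"

lemma subset_facet:
  assumes "simplicial V D" "finite V" "F \<in> D"
  shows "\<exists>H. facet D H \<and> F \<subseteq> H"
  using ex_facet[OF assms] unfolding facet_def by blast

text \<open>The last hypothesis says that \<open>D\<close> is not a single simplex, so there are two
  distinct facets. Among all such pairs one with largest intersection is taken: a further facet
  containing that intersection cannot meet \<open>F1\<close> in more.\<close>

lemma ex_facets_max_inter:
  assumes D: "simplicial V D" and V: "finite V" and ne: "D \<noteq> {}"
    and ns: "\<And>F. F \<in> D \<Longrightarrow> \<exists>H\<in>D. \<not> H \<subseteq> F"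
  shows "\<exists>F1 F2. facet D F1 \<and> facet D F2 \<and> F1 \<noteq> F2 \<and>
    (\<forall>H. facet D H \<longrightarrow> F1 \<inter> F2 \<subseteq> H \<longrightarrow> H \<noteq> F1 \<longrightarrow> H \<inter> F1 = F1 \<inter> F2)"
proof -
  define P where "P p \<longleftrightarrow> facet D (fst p) \<and> facet D (snd p) \<and> fst p \<noteq> snd p" for p
  obtain F0 where "F0 \<in> D" using ne by blast
  then obtain A where A: "facet D A" using subset_facet[OF D V] by blast
  then have "A \<in> D" by (simp add: facet_def)
  then obtain H where H: "H \<in> D" "\<not> H \<subseteq> A" using ns by metis
  then obtain B where B: "facet D B" "H \<subseteq> B" using subset_facet[OF D V] by blast
  have "P (A, B)" using A B H by (auto simp: P_def)
  moreover have "card (fst p \<inter> snd p) < Suc (card V)" if "P p" for p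
  proof -
    have "fst p \<in> D" using that by (simp add: P_def facet_def)
    then have "fst p \<inter> snd p \<subseteq> V" using D by (auto simp: simplicial_def)
    then show ?thesis using card_mono[OF V] by (simp add: less_Suc_eq_le)
  qed
  ultimately obtain p where p: "P p" and max: "\<And>q. P q \<Longrightarrow> card (fst q \<inter> snd q) \<le> card (fst p \<inter> snd p)"
    using ex_has_greatest_nat[of P "(A, B)" "\<lambda>p. card (fst p \<inter> snd p)" "Suc (card V)"] by blast
  obtain F1 F2 where p_eq: "p = (F1, F2)" by (cases p)
  have F: "facet D F1" "facet D F2" "F1 \<noteq> F2" using p by (simp_all add: P_def p_eq)
  have "F1 \<in> D" using F(1) by (simp add: facet_def)
  then have fin: "finite F1" using D V by (auto simp: simplicial_def intro: finite_subset)
  have "H' \<inter> F1 = F1 \<inter> F2" if "facet D H'" "F1 \<inter> F2 \<subseteq> H'" "H' \<noteq> F1" for H'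
  proof (rule sym, rule card_seteq)
    show "finite (H' \<inter> F1)" using fin by simp
    show "F1 \<inter> F2 \<subseteq> H' \<inter> F1" using that by blast
    show "card (H' \<inter> F1) \<le> card (F1 \<inter> F2)"
      using max[of "(H', F1)"] that F by (simp add: P_def p_eq)
  qed
  then show ?thesis using F by blast
qed

text \<open>Take two facets \<open>F\<^sub>1\<close>, \<open>F\<^sub>2\<close> with largest possible intersection \<open>G\<close>.  Then the link of \<open>G\<close> is a
  disjoint union of at least two simplices, and it stays disconnected in the degree with entries
  \<open>-1\<close> on \<open>G\<close> and \<open>s - 1\<close> at one vertex of each of \<open>F\<^sub>1 - F\<^sub>2\<close> and \<open>F\<^sub>2 - F\<^sub>1\<close>.\<close>

lemma nonprime_cohomology_degree:
  assumes D: "simplicial V D" and V: "finite V" and ne: "D \<noteq> {}" and s: "1 \<le> s"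
    and ns: "\<And>F. F \<in> D \<Longrightarrow> \<exists>H\<in>D. \<not> H \<subseteq> F"
  shows "2 * int s - 1 \<in> cohomology_degrees TYPE('k::comm_ring_1) V D s"
proof -
  obtain F1 F2 where facets: "facet D F1" "facet D F2" and F12: "F1 \<noteq> F2"
    and inter: "\<And>H. \<lbrakk>facet D H; F1 \<inter> F2 \<subseteq> H; H \<noteq> F1\<rbrakk> \<Longrightarrow> H \<inter> F1 = F1 \<inter> F2"
    using ex_facets_max_inter[OF D V ne ns] by metis
  have FD: "F1 \<in> D" "F2 \<in> D" and f1: "F1 \<subseteq> F2 \<Longrightarrow> F2 = F1" and f2: "F2 \<subseteq> F1 \<Longrightarrow> F1 = F2"
    using facets by (auto simp: facet_def)
  have FV: "F1 \<subseteq> V" "F2 \<subseteq> V" using D FD by (auto simp: simplicial_def)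
  define G where "G = F1 \<inter> F2"
  have GV: "G \<subseteq> V" using FV by (auto simp: G_def)
  then have finG: "finite G" using V by (rule finite_subset)
  obtain u where u: "u \<in> F1" "u \<notin> F2" using f1 F12 by blast
  obtain v where v: "v \<in> F2" "v \<notin> F1" using f2 F12 by blast
  have uG: "u \<notin> G" and vG: "v \<notin> G" and uv: "u \<noteq> v" using u v by (auto simp: G_def)
  \<comment> \<open>The entries \<open>-1\<close> force every face to contain \<open>G\<close>.
    Their total \<open>- card G\<close> is offset by the position \<open>Suc (card G)\<close>, which
    leaves \<open>1 + 2 * (s - 1)\<close>.\<close>
  define \<gamma> where "\<gamma> i = (if i \<in> G then -1 else 0) + (if i = u then int s - 1 else 0) + (if i = v then int s - 1 else 0)" for i
  have supp: "\<forall>i. i \<notin> V \<longrightarrow> \<gamma> i = 0"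
    using GV u v FV by (auto simp: \<gamma>_def)
  have sumG: "(\<Sum>i\<in>V. if i \<in> G then -1 else (0::int)) = - int (card G)"
    using GV V by (simp add: sum.If_cases Int_absorb1)
  have sum: "(\<Sum>i\<in>V. \<gamma> i) = 2 * (int s - 1) - int (card G)"
    using V u v FV sumG by (simp add: \<gamma>_def sum.distrib subset_iff)
  have neg: "{i. \<gamma> i < 0} = G"
    using uG vG s by (auto simp: \<gamma>_def)
  define T where "T = degree_complex V D (int s) \<gamma>"
  have GT: "G \<subseteq> F" if "F \<in> T" for F using that by (simp add: T_def degree_complex_def neg)
  \<comment> \<open>\<open>G\<close> and \<open>u\<close> lie in \<open>F1\<close>, so off
    \<open>F1\<close> only the entry \<open>s - 1\<close> at \<open>v\<close> counts.\<close>
  have sum1: "(\<Sum>i\<in>V - F1. \<gamma> i) < int s"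
  proof -
    have "(\<Sum>i\<in>V - F1. \<gamma> i) = (\<Sum>i\<in>V - F1. if i = v then int s - 1 else 0)"
      by (rule sum.cong) (use u in \<open>auto simp: \<gamma>_def G_def\<close>)
    then show ?thesis using V v FV by auto
  qed
  have sum2: "(\<Sum>i\<in>V - F2. \<gamma> i) < int s"
  proof -
    have "(\<Sum>i\<in>V - F2. \<gamma> i) = (\<Sum>i\<in>V - F2. if i = u then int s - 1 else 0)"
      by (rule sum.cong) (use v in \<open>auto simp: \<gamma>_def G_def\<close>)
    then show ?thesis using V u FV by auto
  qed
  have T1: "F \<in> T" if "G \<subseteq> F" "F \<subseteq> F1" for F
    unfolding T_def degree_complex_def neg using that FV sum1 FD(1) by blast
  have T2: "F \<in> T" if "G \<subseteq> F" "F \<subseteq> F2" for F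
    unfolding T_def degree_complex_def neg using that FV sum2 FD(2) by blast
  have uT: "insert u G \<in> T" using u by (intro T1) (auto simp: G_def)
  have vT: "insert v G \<in> T" using v by (intro T2) (auto simp: G_def)
  define \<epsilon> where "\<epsilon> x = (if even (card {j \<in> G. j < x}) then 1 else -1 :: 'k)" for x
  define b0 where "b0 F = (if F = G then 1 else 0 :: 'k)" for F
  \<comment> \<open>\<open>cobd b0\<close> cut off to \<open>F1\<close>: up to the signs \<epsilon>,
    the indicator function of the component \<open>F1 - G\<close> of the link of
    \<open>G\<close>.\<close>
  define c where "c F = (if card F = Suc (card G) \<and> G \<subseteq> F \<and> F \<subseteq> F1 then cobd b0 F else 0)" for F
  have c_insert: "c (insert x G) = \<epsilon> x" if "x \<in> F1" "x \<notin> G" for x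
  proof -
    have "cobd b0 (insert x G) = \<epsilon> x"
      by (subst cobd_insert[OF finG that(2)]) (auto simp: b0_def \<epsilon>_def split: if_splits)
    then show ?thesis using that finG by (auto simp: c_def G_def)
  qed
  have c_mem: "c \<in> cochains TYPE('k) T (Suc (card G))"
    using T1 by (auto simp: cochains_def c_def split: if_splits)
  have cyc: "cobd c F = 0" if F: "F \<in> T" "card F = Suc (Suc (card G))" for F
  proof -
    have fin: "finite F" using F(2) card.infinite by fastforce
    obtain F' where "F' \<in> D" "F \<subseteq> F'" using F(1) by (auto simp: T_def degree_complex_def)
    then obtain H where H: "facet D H" "F \<subseteq> H"
      using subset_facet[OF D V] by (meson order_trans)
    show ?thesis
    proof (cases "H = F1")
      case False
      \<comment> \<open>By maximality of the intersection \<open>F\<close> meets \<open>F1\<close>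
        in \<open>G\<close> only. A set \<open>F - {i}\<close> inside \<open>F1\<close> would lie in
        \<open>G\<close> but has one element more, so every term vanishes.\<close>
      have "H \<inter> F1 = G"
        unfolding G_def
        by (rule inter[OF H(1) _ False]) (use H(2) GT[OF F(1)] in \<open>auto simp: G_def\<close>)
      then have FG: "F \<inter> F1 \<subseteq> G" using H(2) by blast
      show ?thesis
      proof (rule cobd_eq_0)
        fix i assume i: "i \<in> F"
        show "c (F - {i}) = 0"
        proof (rule ccontr)
          assume "c (F - {i}) \<noteq> 0"
          then have *: "card (F - {i}) = Suc (card G)" "F - {i} \<subseteq> F1" by (auto simp: c_def split: if_splits)
          then have "F - {i} \<subseteq> G" using FG by blast
          then have "card (F - {i}) \<le> card G" by (rule card_mono[OF finG])
          then show False using * by simp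
        qed
      qed
    next
      case True
      have "card (F - G) = 2"
        using card_Diff_subset[OF finG GT[OF F(1)]] F(2) by simp
      then obtain x y where xy: "F - G = {x, y}" "x < y"
        by (metis card_2_iff insert_commute linorder_neqE_nat)
      then have F_eq: "F = insert x (insert y G)" and xyG: "x \<notin> G" "y \<notin> G" and xyF: "x \<in> F1" "y \<in> F1"
        using GT[OF F(1)] H(2) True by auto
      have Fx: "F - {x} = insert y G" and Fy: "F - {y} = insert x G"
        using F_eq xyG xy(2) by auto
      have c0: "c (F - {i}) = 0" if "i \<in> G" for i
        using that by (auto simp: c_def)
      let ?f = "\<lambda>i. if even (card {j \<in> F. j < i}) then c (F - {i}) else - c (F - {i})"
      have "cobd c F = ?f x + ?f y + sum ?f G"
        unfolding cobd_def using F_eq xyG xy(2) finG by (simp add: add.assoc)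
      also have "sum ?f G = 0" using c0 by (intro sum.neutral) auto
      \<comment> \<open>In \<open>F\<close>, the vertex \<open>y\<close> is preceded by
        \<open>x\<close> in addition to elements of \<open>G\<close>; this one extra position makes
        the terms for \<open>x\<close> and \<open>y\<close> cancel.\<close>
      also have "?f x = \<epsilon> x * \<epsilon> y"
      proof -
        have "{j \<in> F. j < x} = {j \<in> G. j < x}" using F_eq xy(2) by auto
        then show ?thesis by (simp add: Fx c_insert[OF xyF(2) xyG(2)] \<epsilon>_def[of x])
      qed
      also have "?f y = - (\<epsilon> x * \<epsilon> y)"
      proof -
        have "{j \<in> F. j < y} = insert x {j \<in> G. j < y}" using F_eq xy(2) by auto
        then have "card {j \<in> F. j < y} = Suc (card {j \<in> G. j < y})" using xyG finG by simp
        then show ?thesis by (simp add: Fy c_insert[OF xyF(1) xyG(1)] \<epsilon>_def[of y])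
      qed
      finally show ?thesis by simp
    qed
  qed
  have "nontrivial_cohomology TYPE('k) T (Suc (card G))"
    unfolding nontrivial_cohomology_Suc
  proof (intro bexI[OF _ c_mem] conjI ballI impI cyc)
    fix b assume b: "b \<in> cochains TYPE('k) T (card G)"
    \<comment> \<open>Every face contains \<open>G\<close>, so \<open>b\<close> lives on
      \<open>G\<close> alone and its coboundary takes the same value, up to sign, at all
      \<open>insert x G\<close>. But \<open>c\<close> is zero at \<open>v\<close> and a unit at
      \<open>u\<close>.\<close>
    have bG: "cobd b (insert x G) = (if even (card {j \<in> G. j < x}) then b G else - b G)" if "x \<notin> G" for x
      using b GT by (intro cobd_insert[OF finG that]) (auto simp: cochains_def)
    show "\<exists>F\<in>T. card F = Suc (card G) \<and> c F \<noteq> cobd b F"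
    proof (rule ccontr)
      assume "\<not> ?thesis"
      then have eq: "c F = cobd b F" if "F \<in> T" "card F = Suc (card G)" for F using that by blast
      have "c (insert v G) = 0" using v by (simp add: c_def)
      then have "b G = 0" using eq[OF vT] bG[OF vG] vG finG by (auto split: if_splits)
      then have "c (insert u G) = 0" using eq[OF uT] bG[OF uG] uG finG by auto
      then show False using c_insert[OF u(1) uG] by (simp add: \<epsilon>_def split: if_splits)
    qed
  qed
  moreover have "2 * int s - 1 = int (Suc (card G)) + (\<Sum>i\<in>V. \<gamma> i)"
    using sum by simp
  ultimately show ?thesis
    using supp unfolding cohomology_degrees_def T_def by blast
qed

section \<open>The complex of the fiber ideal\<close>

lemma simplicial_degree_complex:
  assumes "{i. \<gamma> i < 0} = {}"
  shows "simplicial V (degree_complex V D s \<gamma>)"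
  unfolding simplicial_def degree_complex_def assms by blast

definition restrict_degree :: "nat set \<Rightarrow> (nat \<Rightarrow> int) \<Rightarrow> nat \<Rightarrow> int" where
  "restrict_degree M \<gamma> i = (if i \<in> M then \<gamma> i else 0)"

lemma sum_restrict_degree: "A \<subseteq> M \<Longrightarrow> (\<Sum>i\<in>A. restrict_degree M \<gamma> i) = (\<Sum>i\<in>A. \<gamma> i)"
  by (rule sum.cong) (auto simp: restrict_degree_def)

text \<open>A face of \<open>D1\<close> avoids \<open>N\<close>, so the sum off it contains all of
  \<gamma> on \<open>N\<close>, which moves into the threshold. If some negative entry lies outside
  \<open>M\<close>, no face of \<open>D1\<close> contains the negative support.\<close>

lemma degree_complex_Un:
  assumes D1: "simplicial M D1" and D2: "simplicial N D2" and disj: "M \<inter> N = {}"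
    and fin: "finite M" "finite N"
  shows "degree_complex (M \<union> N) (D1 \<union> D2) s \<gamma> =
    (if {i. \<gamma> i < 0} \<subseteq> M then degree_complex M D1 (s - (\<Sum>i\<in>N. \<gamma> i)) (restrict_degree M \<gamma>) else {}) \<union>
    (if {i. \<gamma> i < 0} \<subseteq> N then degree_complex N D2 (s - (\<Sum>i\<in>M. \<gamma> i)) (restrict_degree N \<gamma>) else {})"
proof -
  \<comment> \<open>Stated for arbitrary blocks so that it applies a second time with the roles of
    the two complexes exchanged.\<close>
  have *: "{F. F \<subseteq> M \<union> N \<and> {i. \<gamma> i < 0} \<subseteq> F \<and> (\<exists>F'\<in>D1. F \<subseteq> F' \<and> (\<Sum>i\<in>M \<union> N - F'. \<gamma> i) < s)} =
    (if {i. \<gamma> i < 0} \<subseteq> M then degree_complex M D1 (s - (\<Sum>i\<in>N. \<gamma> i)) (restrict_degree M \<gamma>) else {})"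
    if D1: "simplicial M D1" and disj: "M \<inter> N = {}" and fin: "finite M" "finite N" for M N D1
  proof -
    have DM: "F' \<subseteq> M" if "F' \<in> D1" for F' using D1 that by (simp add: simplicial_def)
    have sum: "(\<Sum>i\<in>M \<union> N - F'. \<gamma> i) = (\<Sum>i\<in>M - F'. restrict_degree M \<gamma> i) + (\<Sum>i\<in>N. \<gamma> i)" if "F' \<in> D1" for F'
    proof -
      have "M \<union> N - F' = (M - F') \<union> N" using DM[OF that] disj by blast
      then have "(\<Sum>i\<in>M \<union> N - F'. \<gamma> i) = (\<Sum>i\<in>M - F'. \<gamma> i) + (\<Sum>i\<in>N. \<gamma> i)"
        using disj fin by (simp only:) (rule sum.union_disjoint, auto)
      then show ?thesis by (simp add: sum_restrict_degree)
    qed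
    have sum_iff: "(\<Sum>i\<in>M \<union> N - F'. \<gamma> i) < s \<longleftrightarrow> (\<Sum>i\<in>M - F'. restrict_degree M \<gamma> i) < s - (\<Sum>i\<in>N. \<gamma> i)"
      if "F' \<in> D1" for F'
      using sum[OF that] by linarith
    have bex: "(\<exists>F'\<in>D1. F \<subseteq> F' \<and> (\<Sum>i\<in>M \<union> N - F'. \<gamma> i) < s) \<longleftrightarrow>
        (\<exists>F'\<in>D1. F \<subseteq> F' \<and> (\<Sum>i\<in>M - F'. restrict_degree M \<gamma> i) < s - (\<Sum>i\<in>N. \<gamma> i))" for F
      by (rule bex_cong[OF refl]) (simp only: sum_iff)
    have FM: "F \<subseteq> M" if "\<exists>F'\<in>D1. F \<subseteq> F' \<and> P F'" for F P using DM that by blast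
    show ?thesis
    proof (cases "{i. \<gamma> i < 0} \<subseteq> M")
      case True
      then have "{i. restrict_degree M \<gamma> i < 0} = {i. \<gamma> i < 0}"
        by (auto simp: restrict_degree_def)
      then show ?thesis
        unfolding degree_complex_def bex if_P[OF True] using FM by (intro Collect_cong) auto
    next
      case False
      then show ?thesis unfolding if_not_P[OF False] using FM by blast
    qed
  qed
  have disj': "N \<inter> M = {}" using disj by blast
  have split: "degree_complex (M \<union> N) (D1 \<union> D2) s \<gamma> =
      {F. F \<subseteq> M \<union> N \<and> {i. \<gamma> i < 0} \<subseteq> F \<and> (\<exists>F'\<in>D1. F \<subseteq> F' \<and> (\<Sum>i\<in>M \<union> N - F'. \<gamma> i) < s)} \<union>
      {F. F \<subseteq> M \<union> N \<and> {i. \<gamma> i < 0} \<subseteq> F \<and> (\<exists>F'\<in>D2. F \<subseteq> F' \<and> (\<Sum>i\<in>M \<union> N - F'. \<gamma> i) < s)}"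
    unfolding degree_complex_def by blast
  show ?thesis
    unfolding split using *[OF D1 disj fin] *[OF D2 disj' fin(2,1)] by (simp add: Un_commute[of N M])
qed

text \<open>With \<open>t = s - c\<close> the degree \<open>c\<close> spent on the other block is
  exactly the shift \<open>s - t\<close>. Nontrivial cohomology makes the complex nonempty, which
  gives \<open>t \<ge> 1\<close>; \<open>c \<ge> 0\<close> gives \<open>t \<le> s\<close>.\<close>

lemma cohomology_degrees_shift:
  assumes nt: "nontrivial_cohomology k (degree_complex M D (int s - c) (restrict_degree M \<gamma>)) p"
    and c: "0 \<le> c"
  shows "\<exists>t\<in>{1..s}. int p + (\<Sum>i\<in>M. \<gamma> i) + c - (int s - int t) \<in> cohomology_degrees k M D t"
proof (rule bexI)
  define t where "t = nat (int s - c)"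
  have "\<not> int s - c \<le> 0"
    using nontrivial_cohomology_imp_nonempty[OF nt] degree_complex_empty by blast
  then have t: "int t = int s - c" by (simp add: t_def)
  then show "t \<in> {1..s}" using c \<open>\<not> int s - c \<le> 0\<close> by auto
  have "int p + (\<Sum>i\<in>M. restrict_degree M \<gamma> i) \<in> cohomology_degrees k M D t"
    unfolding cohomology_degrees_def using nt
    by (intro CollectI exI conjI refl) (auto simp: t restrict_degree_def)
  then show "int p + (\<Sum>i\<in>M. \<gamma> i) + c - (int s - int t) \<in> cohomology_degrees k M D t"
    by (simp add: t sum_restrict_degree)
qed

lemma cohomology_degrees_Un_cases:
  assumes D1: "simplicial M D1" and D2: "simplicial N D2" and disj: "M \<inter> N = {}"
    and fin: "finite M" "finite N" and d: "d \<in> cohomology_degrees k (M \<union> N) (D1 \<union> D2) s"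
  shows "(\<exists>t\<in>{1..s}. d - (int s - int t) \<in> cohomology_degrees k M D1 t) \<or>
    (\<exists>t\<in>{1..s}. d - (int s - int t) \<in> cohomology_degrees k N D2 t) \<or> d \<le> 2 * int s - 1"
proof -
  obtain p \<gamma> where d_eq: "d = int p + (\<Sum>i\<in>M \<union> N. \<gamma> i)" and supp: "\<And>i. i \<notin> M \<union> N \<Longrightarrow> \<gamma> i = 0"
    and nt: "nontrivial_cohomology k (degree_complex (M \<union> N) (D1 \<union> D2) (int s) \<gamma>) p"
    using d unfolding cohomology_degrees_def by blast
  define b c where "b = (\<Sum>i\<in>M. \<gamma> i)" and "c = (\<Sum>i\<in>N. \<gamma> i)"
  have d_bc: "d = int p + b + c"
    using sum.union_disjoint[OF fin disj, of \<gamma>] by (simp add: d_eq b_def c_def)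
  define T1 where "T1 = degree_complex M D1 (int s - c) (restrict_degree M \<gamma>)"
  define T2 where "T2 = degree_complex N D2 (int s - b) (restrict_degree N \<gamma>)"
  define neg where "neg = {i. \<gamma> i < 0}"
  have dc: "degree_complex (M \<union> N) (D1 \<union> D2) (int s) \<gamma> =
      (if neg \<subseteq> M then T1 else {}) \<union> (if neg \<subseteq> N then T2 else {})"
    unfolding T1_def T2_def b_def c_def neg_def by (rule degree_complex_Un[OF D1 D2 disj fin])
  have c_nonneg: "0 \<le> c" if "neg \<subseteq> M"
    unfolding c_def using that disj by (intro sum_nonneg) (force simp: neg_def)
  have b_nonneg: "0 \<le> b" if "neg \<subseteq> N"
    unfolding b_def using that disj by (intro sum_nonneg) (force simp: neg_def)
  have case1: ?thesis if "neg \<subseteq> M" "nontrivial_cohomology k T1 p"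
    using cohomology_degrees_shift[OF that(2)[unfolded T1_def] c_nonneg[OF that(1)]]
    by (simp add: d_bc b_def)
  have case2: ?thesis if "neg \<subseteq> N" "nontrivial_cohomology k T2 p"
    using cohomology_degrees_shift[OF that(2)[unfolded T2_def] b_nonneg[OF that(1)]]
    by (simp add: d_bc c_def algebra_simps)
  show ?thesis
  proof (cases "neg \<subseteq> M \<and> neg \<subseteq> N")
    case False
    then consider "neg \<subseteq> M" "\<not> neg \<subseteq> N" | "neg \<subseteq> N" "\<not> neg \<subseteq> M" | "\<not> neg \<subseteq> M" "\<not> neg \<subseteq> N" by blast
    then show ?thesis
    proof cases
      case 1
      then show ?thesis using nt case1 by (simp add: dc)
    next
      case 2
      then show ?thesis using nt case2 by (simp add: dc)
    next
      case 3
      then show ?thesis using nontrivial_cohomology_imp_nonempty[OF nt] by (simp add: dc)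
    qed
  next
    case True
    then have nt': "nontrivial_cohomology k (T1 \<union> T2) p" using nt by (simp add: dc)
    show ?thesis
    proof (cases "T1 = {} \<or> T2 = {}")
      case True': True
      then show ?thesis using nt' True case1 case2 by auto
    next
      case False
      \<comment> \<open>So \<open>b\<close> and \<open>c\<close> are at most \<open>s - 1\<close>,
        which in positions \<open>p \<le> 1\<close> already gives
        \<open>d \<le> 1 + 2 * (s - 1)\<close>.\<close>
      then have "int s - c > 0" "int s - b > 0"
        using degree_complex_empty unfolding T1_def T2_def by (meson not_less)+
      show ?thesis
      proof (cases "p \<le> 1")
        case True
        then show ?thesis using \<open>int s - c > 0\<close> \<open>int s - b > 0\<close> by (simp add: d_bc)
      next
        case False
        then obtain q where p: "p = Suc (Suc q)" by (metis One_nat_def not_less_eq_eq Suc_le_D)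
        have "{i. restrict_degree M \<gamma> i < 0} = {}" "{i. restrict_degree N \<gamma> i < 0} = {}"
          using True disj by (auto simp: neg_def restrict_degree_def)
        then have "simplicial M T1" "simplicial N T2"
          unfolding T1_def T2_def by (simp_all add: simplicial_degree_complex)
        then have "nontrivial_cohomology k T1 p \<or> nontrivial_cohomology k T2 p"
          using nt' nontrivial_cohomology_Un_iff[OF _ _ disj] unfolding p by blast
        then show ?thesis using True case1 case2 by blast
      qed
    qed
  qed
qed

text \<open>Placing \<open>s - t\<close> on one vertex \<open>v\<close> of \<open>N\<close> lowers
  the threshold for \<open>D1\<close> from \<open>s\<close> to \<open>t\<close>. The second
  alternative covers classes in positions at most 1, which the other complex may kill.\<close>

lemma cohomology_degrees_UnI:
  assumes D1: "simplicial M D1" and D2: "simplicial N D2" and disj: "M \<inter> N = {}"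
    and fin: "finite M" "finite N" and N: "N \<noteq> {}" and t: "1 \<le> t" "t \<le> s"
    and d: "d \<in> cohomology_degrees k M D1 t"
  shows "d + (int s - int t) \<in> cohomology_degrees k (M \<union> N) (D1 \<union> D2) s \<or>
    d + (int s - int t) \<le> 2 * int s - 1"
proof -
  obtain p \<beta> where d_eq: "d = int p + (\<Sum>i\<in>M. \<beta> i)" and supp: "\<And>i. i \<notin> M \<Longrightarrow> \<beta> i = 0"
    and nt: "nontrivial_cohomology k (degree_complex M D1 (int t) \<beta>) p"
    using d unfolding cohomology_degrees_def by blast
  obtain v where v: "v \<in> N" using N by blast
  have vM: "v \<notin> M" using v disj by blast
  define \<gamma> where "\<gamma> i = \<beta> i + (if i = v then int s - int t else 0)" for i
  have supp': "\<And>i. i \<notin> M \<union> N \<Longrightarrow> \<gamma> i = 0" using supp v by (auto simp: \<gamma>_def)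
  have restr: "restrict_degree M \<gamma> = \<beta>"
    using supp vM by (auto simp: fun_eq_iff restrict_degree_def \<gamma>_def)
  have "(\<Sum>i\<in>N. \<gamma> i) = (\<Sum>i\<in>N. if i = v then int s - int t else 0)"
    by (rule sum.cong) (use supp disj in \<open>auto simp: \<gamma>_def\<close>)
  then have sumN: "(\<Sum>i\<in>N. \<gamma> i) = int s - int t" using v fin by simp
  have sumM: "(\<Sum>i\<in>M. \<gamma> i) = (\<Sum>i\<in>M. \<beta> i)"
    by (rule sum.cong) (use vM in \<open>auto simp: \<gamma>_def\<close>)
  define T2 where "T2 = degree_complex N D2 (int s - (\<Sum>i\<in>M. \<gamma> i)) (restrict_degree N \<gamma>)"
  have negM: "{i. \<gamma> i < 0} \<subseteq> M"
    using supp vM t by (force simp: \<gamma>_def split: if_splits)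
  have dc: "degree_complex (M \<union> N) (D1 \<union> D2) (int s) \<gamma> =
      degree_complex M D1 (int t) \<beta> \<union> (if {i. \<gamma> i < 0} \<subseteq> N then T2 else {})"
    using degree_complex_Un[OF D1 D2 disj fin, where s = "int s"] negM by (simp add: restr sumN T2_def)
  have mem: "d + (int s - int t) \<in> cohomology_degrees k (M \<union> N) (D1 \<union> D2) s"
    if "nontrivial_cohomology k (degree_complex (M \<union> N) (D1 \<union> D2) (int s) \<gamma>) p"
  proof -
    have "d + (int s - int t) = int p + (\<Sum>i\<in>M \<union> N. \<gamma> i)"
      using sum.union_disjoint[OF fin disj, of \<gamma>] by (simp add: d_eq sumN sumM)
    then show ?thesis using that supp' unfolding cohomology_degrees_def by blast
  qed
  show ?thesis
  proof (cases "{i. \<gamma> i < 0} \<subseteq> N \<and> T2 \<noteq> {}")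
    case False
    then have "degree_complex (M \<union> N) (D1 \<union> D2) (int s) \<gamma> = degree_complex M D1 (int t) \<beta>"
      by (auto simp: dc)
    then show ?thesis using mem nt by simp
  next
    case True
    \<comment> \<open>Now \<beta> adds up to at most \<open>s - 1\<close>; with
      \<open>p \<le> 1\<close> and \<open>t \<ge> 1\<close> the shifted degree is at most
      \<open>1 + (s - 1) + (s - 1)\<close>.\<close>
    then have "int s - (\<Sum>i\<in>M. \<gamma> i) > 0"
      using degree_complex_empty unfolding T2_def by (meson not_less)
    show ?thesis
    proof (cases "p \<le> 1")
      case True
      then show ?thesis using \<open>int s - (\<Sum>i\<in>M. \<gamma> i) > 0\<close> t by (simp add: d_eq sumM)
    next
      case False
      then obtain q where p: "p = Suc (Suc q)" by (metis One_nat_def not_less_eq_eq Suc_le_D)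
      have neg: "{i. \<gamma> i < 0} = {}" using True negM disj by blast
      then have "{i. restrict_degree N \<gamma> i < 0} = {}" "{i. \<beta> i < 0} = {}"
        unfolding restr[symmetric] by (auto simp: restrict_degree_def)
      then have "simplicial M (degree_complex M D1 (int t) \<beta>)" "simplicial N T2"
        unfolding T2_def by (simp_all add: simplicial_degree_complex)
      then have "nontrivial_cohomology k (degree_complex M D1 (int t) \<beta> \<union> T2) p"
        using nt nontrivial_cohomology_Un_iff[OF _ _ disj] unfolding p by blast
      then show ?thesis using mem True by (simp add: dc)
    qed
  qed
qed

section \<open>The regularity formula\<close>

lemma empty_mem_of_sr_ideal_proper:
  assumes "simplicial V D" "sr_ideal V D \<noteq> carrier (poly_ring V)"
  shows "{} \<in> D"
proof (rule ccontr)
  assume "{} \<notin> D"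
  then have "D = {}" using assms(1) by (auto simp: simplicial_def)
  then show False using assms(2) by (auto simp: sr_ideal_def mon_ideal_def)
qed

text \<open>Properness of \<open>I\<close> and \<open>J\<close> puts the empty face into both
  complexes. The bounds on \<open>m\<close> make both blocks of variables nonempty, so that a shift
  can always be placed in the other block.\<close>

theorem theorem1p3:
  fixes m n s :: nat
    and I J :: "'k::field_char_0 mpoly set"
  assumes "1 \<le> m" and "m < n" and "1 \<le> s"
    and "squarefree_monomial_ideal {1..m} I"
    and "squarefree_monomial_ideal {m+1..n} J"
    and "I \<noteq> carrier (poly_ring {1..m})"
    and "J \<noteq> carrier (poly_ring {m+1..n})"
    and "\<not> primeideal (fiber_ideal m n I J) (poly_ring {1..n})"
  shows "reg_quot {1..n} (symbolic_power (poly_ring {1..n}) (fiber_ideal m n I J) s) =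
    Max (\<Union>t\<in>{1..s}.
      {reg_quot {1..m} (symbolic_power (poly_ring {1..m}) I t) + ereal (real s - real t),
       reg_quot {m+1..n} (symbolic_power (poly_ring {m+1..n}) J t) + ereal (real s - real t),
       ereal (2 * real s - 1)})"
proof -
  obtain D1 where D1: "simplicial {1..m} D1" and I: "I = sr_ideal {1..m} D1"
    using squarefree_imp_sr_ideal[OF assms(4)] by blast
  obtain D2 where D2: "simplicial {m+1..n} D2" and J: "J = sr_ideal {m+1..n} D2"
    using squarefree_imp_sr_ideal[OF assms(5)] by blast
  have e1: "{} \<in> D1" by (rule empty_mem_of_sr_ideal_proper[OF D1]) (use assms(6) I in blast)
  have e2: "{} \<in> D2" by (rule empty_mem_of_sr_ideal_proper[OF D2]) (use assms(7) J in blast)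
  define M N where "M = {1..m}" and "N = {m+1..n}"
  have MN: "M \<inter> N = {}" "N \<inter> M = {}" "finite M" "finite N" "M \<noteq> {}" "N \<noteq> {}"
    using assms(1,2) by (auto simp: M_def N_def)
  have V: "{1..n} = M \<union> N" using assms(1,2) by (auto simp: M_def N_def)
  define D where "D = D1 \<union> D2"
  have fiber: "fiber_ideal m n I J = sr_ideal (M \<union> N) D"
    unfolding I J D_def V[symmetric] using assms(2) by (intro fiber_ideal_sr_ideal[OF D1 e1 D2 e2]) simp
  note D1 = D1[folded M_def] and D2 = D2[folded N_def]
  have D1D: "F \<subseteq> M \<and> Pow F \<subseteq> D1" if "F \<in> D1" for F using D1 that by (simp add: simplicial_def)
  have D2D: "F \<subseteq> N \<and> Pow F \<subseteq> D2" if "F \<in> D2" for F using D2 that by (simp add: simplicial_def)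
  have D: "simplicial (M \<union> N) D"
    unfolding simplicial_def D_def by (auto dest!: D1D D2D)
  have fin: "finite (M \<union> N)" using MN by simp
  \<comment> \<open>A face containing all others would make \<open>D\<close> a full simplex, whose
    ideal is generated by variables and hence prime.\<close>
  have ns: "\<exists>H\<in>D. \<not> H \<subseteq> F" if F: "F \<in> D" for F
  proof (rule ccontr)
    assume "\<not> ?thesis"
    then have "D \<subseteq> Pow F" by blast
    moreover have "F \<subseteq> M \<union> N" "Pow F \<subseteq> D" using D F by (simp_all add: simplicial_def)
    ultimately have "D = Pow F" "F \<subseteq> M \<union> N" by auto
    then show False
      using primeideal_sr_ideal_Pow[of F "M \<union> N"] assms(8) unfolding fiber V by auto
  qed
  have lower: "2 * int s - 1 \<in> cohomology_degrees TYPE('k) (M \<union> N) D s"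
    by (rule nonprime_cohomology_degree[OF D fin _ assms(3) ns]) (use e1 in \<open>auto simp: D_def\<close>)
  define r where "r = reg_quot (M \<union> N) (symbolic_power (poly_ring (M \<union> N)) (sr_ideal (M \<union> N) D :: 'k mpoly set) s)"
  define rI where "rI t = reg_quot M (symbolic_power (poly_ring M) I t)" for t
  define rJ where "rJ t = reg_quot N (symbolic_power (poly_ring N) J t)" for t
  define A where "A = (\<Union>t\<in>{1..s}. {rI t + ereal (real s - real t), rJ t + ereal (real s - real t), ereal (2 * real s - 1)})"
  have rI: "rI t = Sup ((\<lambda>d. ereal (of_int d)) ` cohomology_degrees TYPE('k) M D1 t)" for t
    unfolding rI_def I M_def[symmetric] by (rule reg_quot_symbolic_power[OF D1 MN(3)])
  have rJ: "rJ t = Sup ((\<lambda>d. ereal (of_int d)) ` cohomology_degrees TYPE('k) N D2 t)" for t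
    unfolding rJ_def J N_def[symmetric] by (rule reg_quot_symbolic_power[OF D2 MN(4)])
  have r: "r = Sup ((\<lambda>d. ereal (of_int d)) ` cohomology_degrees TYPE('k) (M \<union> N) D s)"
    unfolding r_def by (rule reg_quot_symbolic_power[OF D fin])
  have r_ge: "ereal (of_int d) \<le> r" if "d \<in> cohomology_degrees TYPE('k) (M \<union> N) D s" for d
    unfolding r using that by (intro Sup_upper) simp
  have r_ge2: "ereal (2 * real s - 1) \<le> r"
    using r_ge[OF lower] by simp
  have finA: "finite A" "A \<noteq> {}" using assms(3) by (auto simp: A_def)
  have "r = Max A"
  proof (rule antisym)
    show "r \<le> Max A"
      unfolding r
    proof (rule Sup_least, elim imageE)
      fix x d assume x: "x = ereal (of_int d)" and d: "d \<in> cohomology_degrees TYPE('k) (M \<union> N) D s"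
      have shift: "x \<le> Max A" if t: "t \<in> {1..s}" and le: "ereal (of_int (d - (int s - int t))) \<le> y"
        and y: "y + ereal (real s - real t) \<in> A" for t y
      proof -
        have "x = ereal (of_int (d - (int s - int t))) + ereal (real s - real t)" by (simp add: x)
        also have "\<dots> \<le> y + ereal (real s - real t)" using le by (rule add_right_mono)
        also have "\<dots> \<le> Max A" using finA y by simp
        finally show ?thesis .
      qed
      consider (1) t where "t \<in> {1..s}" "d - (int s - int t) \<in> cohomology_degrees TYPE('k) M D1 t"
        | (2) t where "t \<in> {1..s}" "d - (int s - int t) \<in> cohomology_degrees TYPE('k) N D2 t"
        | (3) "d \<le> 2 * int s - 1"
        using cohomology_degrees_Un_cases[OF D1 D2 MN(1,3,4) d[unfolded D_def]] by blast
      then show "x \<le> Max A"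
      proof cases
        case 1
        then show ?thesis
          by (intro shift[of t "rI t"]) (auto simp: A_def rI intro!: Sup_upper imageI simp del: of_int_diff)
      next
        case 2
        then show ?thesis
          by (intro shift[of t "rJ t"]) (auto simp: A_def rJ intro!: Sup_upper imageI simp del: of_int_diff)
      next
        case 3
        have "x \<le> ereal (of_int (2 * int s - 1))" using 3 unfolding x by (simp only: ereal_less_eq of_int_le_iff)
        also have "\<dots> \<le> Max A" using finA assms(3) by (intro Max_ge) (auto simp: A_def)
        finally show ?thesis .
      qed
    qed
    \<comment> \<open>Used for both blocks: a shifted degree that does not occur for the union is at
      most \<open>2 * int s - 1\<close>, which occurs by \<open>lower\<close>. The shift is finite,
      so it can be moved to the other side and the supremum bounded element by element.\<close>
    have le: "Sup ((\<lambda>d. ereal (of_int d)) ` E) + ereal (real s - real t) \<le> r"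
      if E: "\<And>d. d \<in> E \<Longrightarrow> d + (int s - int t) \<in> cohomology_degrees TYPE('k) (M \<union> N) D s \<or>
          d + (int s - int t) \<le> 2 * int s - 1" for E t
    proof -
      have "Sup ((\<lambda>d. ereal (of_int d)) ` E) \<le> r - ereal (real s - real t)"
      proof (rule Sup_least, elim imageE)
        fix x d assume x: "x = ereal (of_int d)" and d: "d \<in> E"
        have "ereal (of_int (d + (int s - int t))) \<le> r"
          using E[OF d]
        proof
          assume "d + (int s - int t) \<le> 2 * int s - 1"
          then have "ereal (of_int (d + (int s - int t))) \<le> ereal (of_int (2 * int s - 1))"
            by (simp only: ereal_less_eq of_int_le_iff)
          then show ?thesis using r_ge[OF lower] by (rule order_trans)
        qed (rule r_ge)
        then show "x \<le> r - ereal (real s - real t)"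
          by (simp add: x ereal_le_minus)
      qed
      then show ?thesis by (simp add: ereal_le_minus)
    qed
    show "Max A \<le> r"
    proof (rule Max.boundedI[OF finA])
      fix a assume "a \<in> A"
      then obtain t where t: "1 \<le> t" "t \<le> s"
        and "a = rI t + ereal (real s - real t) \<or> a = rJ t + ereal (real s - real t) \<or> a = ereal (2 * real s - 1)"
        by (auto simp: A_def)
      then consider "a = rI t + ereal (real s - real t)" | "a = rJ t + ereal (real s - real t)"
        | "a = ereal (2 * real s - 1)" by blast
      then show "a \<le> r"
      proof cases
        case 1
        show ?thesis
          unfolding 1 rI
          by (rule le) (unfold D_def, rule cohomology_degrees_UnI[OF D1 D2 MN(1,3,4,6) t])
      next
        case 2
        have comm: "M \<union> N = N \<union> M" "D = D2 \<union> D1" by (auto simp: D_def)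
        show ?thesis
          unfolding 2 rJ
          by (rule le) (unfold comm, rule cohomology_degrees_UnI[OF D2 D1 MN(2,4,3,5) t])
      next
        case 3
        then show ?thesis using r_ge2 by simp
      qed
    qed
  qed
  then show ?thesis
    unfolding fiber V r_def A_def rI_def rJ_def M_def N_def .
qed

end
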